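(* Let $p$ be a prime and let $G$ be a group of order $p^7$ such that $Z(G)$ is not contained in $G'$ and $G$ has nilpotency class at least $3$. Then $Z(\mathrm{Inn}(G))=\mathrm{Aut}_c^{Z}(G)<\mathrm{Aut}_c(G)$ (i.e., $\mathrm{Aut}_c^{Z}(G)$ equals $Z(\mathrm{Inn}(G))$ and is a proper subgroup of $\mathrm{Aut}_c(G)$) if and only if $Z(G)\cong C_{p^2}$, $|G'|=p^4$, and $G$ has nilpotency class $4$.
   Context: $G'$ is the commutator subgroup and $Z(G)$ the center of $G$; $C_{p^2}$ is the cyclic group of order $p^2$. $\mathrm{Inn}(G)$ is the group of inner automorphisms of $G$. An automorphism $\alpha$ of $G$ is central if $x^{-1}\alpha(x)\in Z(G)$ for all $x\in G$; $\mathrm{Aut}_c(G)$ denotes the group of all central automorphisms of $G$, and $\mathrm{Aut}_c^{Z}(G)$ the subgroup of central automorphisms fixing every element of $Z(G)$. *)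

theory Defs
  imports "HOL-Algebra.Algebra"
begin

definition center :: "('a, 'b) monoid_scheme \<Rightarrow> 'a set" where
  "center G = {z \<in> carrier G. \<forall>x \<in> carrier G. z \<otimes>\<^bsub>G\<^esub> x = x \<otimes>\<^bsub>G\<^esub> z}"

abbreviation commutator_subgroup :: "('a, 'b) monoid_scheme \<Rightarrow> 'a set" where
  "commutator_subgroup G \<equiv> derived G (carrier G)"

text \<open>Lower central series, indexed from 0: lcs G 0 = G = gamma_1,
  lcs G (Suc n) = [G, lcs G n] = gamma_(n+2).\<close>
fun lcs :: "('a, 'b) monoid_scheme \<Rightarrow> nat \<Rightarrow> 'a set" where
  "lcs G 0 = carrier G"
| "lcs G (Suc n) = generate G
     (\<Union>x \<in> carrier G. \<Union>y \<in> lcs G n.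
        {x \<otimes>\<^bsub>G\<^esub> y \<otimes>\<^bsub>G\<^esub> inv\<^bsub>G\<^esub> x \<otimes>\<^bsub>G\<^esub> inv\<^bsub>G\<^esub> y})"

definition nilpotency_class :: "('a, 'b) monoid_scheme \<Rightarrow> nat" where
  "nilpotency_class G = (LEAST c. lcs G c = {\<one>\<^bsub>G\<^esub>})"

text \<open>Inner automorphisms, as extensional functions (matching auto G).\<close>
definition inn_aut :: "('a, 'b) monoid_scheme \<Rightarrow> 'a \<Rightarrow> ('a \<Rightarrow> 'a)" where
  "inn_aut G g = (\<lambda>x \<in> carrier G. g \<otimes>\<^bsub>G\<^esub> x \<otimes>\<^bsub>G\<^esub> inv\<^bsub>G\<^esub> g)"

definition Inn :: "('a, 'b) monoid_scheme \<Rightarrow> ('a \<Rightarrow> 'a) set" where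
  "Inn G = inn_aut G ` carrier G"

definition InnGroup :: "('a, 'b) monoid_scheme \<Rightarrow> ('a \<Rightarrow> 'a) monoid" where
  "InnGroup G = (AutoGroup G) \<lparr>carrier := Inn G\<rparr>"

definition Aut_c :: "('a, 'b) monoid_scheme \<Rightarrow> ('a \<Rightarrow> 'a) set" where
  "Aut_c G = {\<alpha> \<in> auto G. \<forall>x \<in> carrier G. inv\<^bsub>G\<^esub> x \<otimes>\<^bsub>G\<^esub> \<alpha> x \<in> center G}"

definition Aut_cZ :: "('a, 'b) monoid_scheme \<Rightarrow> ('a \<Rightarrow> 'a) set" where
  "Aut_cZ G = {\<alpha> \<in> Aut_c G. \<forall>z \<in> center G. \<alpha> z = z}"

end

theory Submission
  imports Defs
begin

text \<open>
  Write \<open>Z\<close>, \<open>Z2\<close>, \<open>Z3\<close> for the upper central series and \<open>D = G'Z\<close>. The centre of \<open>Inn G\<close> is the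
  image of \<open>Z2\<close>, and a central automorphism fixing \<open>Z\<close> is \<open>x \<mapsto> x h(x)\<close> for a homomorphism
  \<open>h : G/D \<rightarrow> Z\<close>. The equality \<open>Z(Inn G) = Aut_cZ G\<close> thus says that each such \<open>h\<close> is a commutator map
  with an element of \<open>Z2\<close>.

  If it holds, such an \<open>h\<close> has values in \<open>G'\<close>, so an element of \<open>Z - G'\<close> of order \<open>p ^ s\<close> forces
  \<open>G/D\<close> to have exponent at most \<open>p ^ (s - 1)\<close>. Then the maps \<open>h\<close> separate the subgroups between \<open>D\<close>
  and \<open>G\<close>, whence \<open>|G : D| \<le> |Z2 : Z|\<close>. For order \<open>p ^ 7\<close> and class at least 3 the only possibility
  is \<open>|Z| = p ^ 2\<close>, \<open>|Z2| = p ^ 4\<close>, \<open>|D| = p ^ 5\<close>, and the three invariants follow.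

  Conversely, the invariants give \<open>|D| = p ^ 5\<close> and \<open>|Z2| = p ^ 4\<close>. As \<open>G/D\<close> is not cyclic, it is
  elementary abelian of rank 2, so there are at most \<open>p ^ 2 = |Z2 : Z|\<close> maps \<open>h\<close>. A character of
  \<open>G/G'\<close> that is nontrivial on an element of \<open>Z - G'\<close> yields a central automorphism moving \<open>Z\<close>.
\<close>

section \<open>Elements central modulo a normal subgroup\<close>

text \<open>For normal \<open>N\<close> this is the preimage of \<open>Z(G/N)\<close>.\<close>

definition central_mod :: "('a, 'b) monoid_scheme \<Rightarrow> 'a set \<Rightarrow> 'a set" where
  "central_mod G N = {g \<in> carrier G. \<forall>x \<in> carrier G.
     x \<otimes>\<^bsub>G\<^esub> g \<otimes>\<^bsub>G\<^esub> inv\<^bsub>G\<^esub> x \<otimes>\<^bsub>G\<^esub> inv\<^bsub>G\<^esub> g \<in> N}"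

context group
begin

lemma commutator_eq_one_iff:
  assumes "x \<in> carrier G" "y \<in> carrier G"
  shows "x \<otimes> y \<otimes> inv x \<otimes> inv y = \<one> \<longleftrightarrow> x \<otimes> y = y \<otimes> x"
proof -
  have "x \<otimes> y \<otimes> inv x \<otimes> inv y = (x \<otimes> y) \<otimes> inv (y \<otimes> x)"
    using assms by (simp add: inv_mult_group m_assoc)
  then show ?thesis
    using assms by (metis inv_equality inv_inv inv_closed m_closed r_inv)
qed

lemma center_commute: "z \<in> center G \<Longrightarrow> x \<in> carrier G \<Longrightarrow> z \<otimes> x = x \<otimes> z"
  by (simp add: center_def)

lemma subgroup_center: "subgroup (center G) G"
proof (rule subgroupI)
  show "center G \<subseteq> carrier G" "center G \<noteq> {}"
    by (auto simp: center_def)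
next
  fix a assume a: "a \<in> center G"
  have "inv a \<otimes> x = x \<otimes> inv a" if "x \<in> carrier G" for x
  proof -
    have "a \<in> carrier G" "a \<otimes> inv x = inv x \<otimes> a"
      using a that by (auto simp: center_def)
    then have "inv (a \<otimes> inv x) = inv (inv x \<otimes> a)" by simp
    then show ?thesis
      using \<open>a \<in> carrier G\<close> that by (simp add: inv_mult_group)
  qed
  with a show "inv a \<in> center G"
    by (auto simp: center_def)
next
  fix a b assume ab: "a \<in> center G" "b \<in> center G"
  have "a \<otimes> b \<otimes> x = x \<otimes> (a \<otimes> b)" if x: "x \<in> carrier G" for x
  proof -
    have c: "a \<in> carrier G" "b \<in> carrier G" "a \<otimes> x = x \<otimes> a" "b \<otimes> x = x \<otimes> b"
      using ab x by (auto simp: center_def)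
    have "a \<otimes> b \<otimes> x = a \<otimes> x \<otimes> b"
      using c(1,2,4) x by (simp add: m_assoc)
    then show ?thesis
      using c(1-3) x by (simp add: m_assoc)
  qed
  moreover have "a \<in> carrier G" "b \<in> carrier G"
    using ab by (auto simp: center_def)
  ultimately show "a \<otimes> b \<in> center G"
    by (simp add: center_def)
qed

lemma pow_mem_center: "z \<in> center G \<Longrightarrow> z [^] (i::nat) \<in> center G"
  by (induction i) (simp_all add: subgroup.one_closed[OF subgroup_center] subgroup.m_closed[OF subgroup_center])

lemma normal_center: "center G \<lhd> G"
proof (rule normal_invI[OF subgroup_center])
  fix x h assume "x \<in> carrier G" "h \<in> center G"
  then show "x \<otimes> h \<otimes> inv x \<in> center G"
    by (metis (mono_tags, lifting) center_def inv_solve_right' mem_Collect_eq m_closed)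
qed

text \<open>Powers of \<open>a\<close> commute with each other and central factors move freely, so
  any two products of a power of \<open>a\<close> and a central element commute.\<close>

lemma center_eq_carrier_if_cyclic_mod_center:
  assumes a: "a \<in> carrier G"
    and gen: "\<And>x. x \<in> carrier G \<Longrightarrow> \<exists>i::nat. \<exists>c \<in> center G. x = a [^] i \<otimes> c"
  shows "center G = carrier G"
proof -
  have "x \<otimes> y = y \<otimes> x" if xy: "x \<in> carrier G" "y \<in> carrier G" for x y
  proof -
    obtain i :: nat and c where c: "c \<in> center G" "x = a [^] i \<otimes> c"
      using gen xy by blast
    obtain j :: nat and d where d: "d \<in> center G" "y = a [^] j \<otimes> d"
      using gen xy by blast
    have cd: "c \<in> carrier G" "d \<in> carrier G"
      "\<And>u. u \<in> carrier G \<Longrightarrow> c \<otimes> u = u \<otimes> c" "\<And>u. u \<in> carrier G \<Longrightarrow> d \<otimes> u = u \<otimes> d"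
      using c d by (auto simp: center_def)
    have "x \<otimes> y = a [^] i \<otimes> (c \<otimes> (a [^] j \<otimes> d))"
      using c d cd(1,2) a by (simp add: m_assoc)
    also have "\<dots> = a [^] i \<otimes> a [^] j \<otimes> d \<otimes> c"
      using cd(1,2) cd(3)[of "a [^] j \<otimes> d"] a by (simp add: m_assoc)
    also have "\<dots> = a [^] j \<otimes> a [^] i \<otimes> d \<otimes> c"
      using a by (simp add: nat_pow_mult add.commute)
    also have "\<dots> = a [^] j \<otimes> (d \<otimes> a [^] i) \<otimes> c"
      using cd(1,2) cd(4)[of "a [^] i"] a by (simp add: m_assoc)
    also have "\<dots> = y \<otimes> x"
      using c d cd(1,2) a by (simp add: m_assoc)
    finally show ?thesis .
  qed
  then show ?thesis by (auto simp: center_def)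
qed

lemma coset_eq_iff:
  assumes "subgroup N G" "x \<in> carrier G" "y \<in> carrier G"
  shows "N #> x = N #> y \<longleftrightarrow> x \<otimes> inv y \<in> N"
proof -
  interpret N: subgroup N G by fact
  show ?thesis
    using assms N.rcos_module[OF is_group assms(3,2)] rcos_self[OF assms(2,1)]
      repr_independence[OF _ assms(3,1)] by metis
qed

lemma center_eq_central_mod: "center G = central_mod G {\<one>}"
  by (auto simp: center_def central_mod_def commutator_eq_one_iff)

lemma central_mod_eq_carrier_iff:
  assumes "subgroup N G"
  shows "central_mod G N = carrier G \<longleftrightarrow> derived G (carrier G) \<subseteq> N"
proof
  assume "central_mod G N = carrier G"
  then have "derived_set G (carrier G) \<subseteq> N"
    by (auto simp: central_mod_def)
  then show "derived G (carrier G) \<subseteq> N"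
    unfolding derived_def using generate_subgroup_incl[OF _ assms] by blast
next
  assume *: "derived G (carrier G) \<subseteq> N"
  have "derived_set G (carrier G) \<subseteq> N"
    using * unfolding derived_def by (rule subset_trans[rotated]) (rule subsetI, rule generate.incl)
  then show "central_mod G N = carrier G"
    by (auto simp: central_mod_def)
qed

lemma commutator_mem_derived:
  "x \<in> carrier G \<Longrightarrow> y \<in> carrier G \<Longrightarrow> x \<otimes> y \<otimes> inv x \<otimes> inv y \<in> derived G (carrier G)"
  unfolding derived_def by (rule generate.incl) blast

lemma normal_if_derived_subset:
  assumes "subgroup B G" "derived G (carrier G) \<subseteq> B"
  shows "B \<lhd> G"
proof (rule normal_invI[OF assms(1)])
  fix x h assume xh: "x \<in> carrier G" "h \<in> B"
  interpret B: subgroup B G by fact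
  have "x \<otimes> h \<otimes> inv x \<otimes> inv h \<in> B"
    using commutator_mem_derived assms xh by auto
  then have "x \<otimes> h \<otimes> inv x \<otimes> inv h \<otimes> h \<in> B"
    using xh by blast
  then show "x \<otimes> h \<otimes> inv x \<in> B"
    using xh by (simp add: m_assoc)
qed

text \<open>One step down \<open>lcs\<close> is exchanged for one step up
  \<open>central_mod\<close>; iterating this compares the lower with the upper central
  series.\<close>

lemma lcs_Suc_subset_iff:
  assumes "subgroup N G" "lcs G k \<subseteq> carrier G"
  shows "lcs G (Suc k) \<subseteq> N \<longleftrightarrow> lcs G k \<subseteq> central_mod G N"
proof
  assume "lcs G (Suc k) \<subseteq> N"
  then have "(\<Union>x \<in> carrier G. \<Union>y \<in> lcs G k. {x \<otimes> y \<otimes> inv x \<otimes> inv y}) \<subseteq> N"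
    unfolding lcs.simps by (rule subset_trans[rotated]) (rule subsetI, rule generate.incl)
  then show "lcs G k \<subseteq> central_mod G N"
    using assms by (auto simp: central_mod_def)
next
  assume "lcs G k \<subseteq> central_mod G N"
  then have "(\<Union>x \<in> carrier G. \<Union>y \<in> lcs G k. {x \<otimes> y \<otimes> inv x \<otimes> inv y}) \<subseteq> N"
    by (auto simp: central_mod_def)
  then show "lcs G (Suc k) \<subseteq> N"
    using generate_subgroup_incl[OF _ assms(1)] by simp
qed

lemma subgroup_lcs: "subgroup (lcs G k) G"
proof (induction k)
  case 0
  then show ?case by (simp add: subgroup_self)
next
  case (Suc k)
  then have "lcs G k \<subseteq> carrier G" by (rule subgroup.subset)
  then show ?case by (auto intro!: generate_is_subgroup)
qed

lemma lcs_1: "lcs G (Suc 0) = derived G (carrier G)"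
  by (simp add: derived_def)

end

context normal
begin

lemma coset_pow_mult:
  assumes "a \<in> carrier G" "x \<in> carrier G"
    and "H #> x = (H #> a) [^]\<^bsub>G Mod H\<^esub> (i::nat)"
  shows "\<exists>n \<in> H. x = a [^] i \<otimes> n"
proof -
  have "H #> x = a [^] i <# H"
    using assms coset_eq FactGroup_pow[OF assms(1)] by auto
  then have "x \<in> a [^] i <# H"
    using rcos_self[OF assms(2) is_subgroup] by simp
  then show ?thesis by (auto simp: l_coset_def)
qed

text \<open>The commutator of \<open>x\<close> and \<open>g\<close> is the quotient of
  \<open>x \<otimes> g\<close> by \<open>g \<otimes> x\<close>, so it lies in \<open>H\<close>
  exactly when these two products have the same coset.\<close>

lemma central_mod_iff:
  "g \<in> central_mod G H \<longleftrightarrow> g \<in> carrier G \<and> H #> g \<in> center (G Mod H)"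
proof -
  have "x \<otimes> g \<otimes> inv x \<otimes> inv g \<in> H \<longleftrightarrow> (H #> g) <#> (H #> x) = (H #> x) <#> (H #> g)"
    if "g \<in> carrier G" "x \<in> carrier G" for x
  proof -
    have "x \<otimes> g \<otimes> inv x \<otimes> inv g = (x \<otimes> g) \<otimes> inv (g \<otimes> x)"
      using that by (simp add: inv_mult_group m_assoc)
    then show ?thesis
      using that coset_eq_iff[OF is_subgroup, of "x \<otimes> g" "g \<otimes> x"] by (auto simp: rcos_sum)
  qed
  then show ?thesis
    by (auto simp: central_mod_def center_def carrier_FactGroup)
qed

text \<open>A subgroup of \<open>G Mod H\<close> is a set of cosets, and its union is its preimage
  in \<open>G\<close>. Normality and cardinality of \<open>central_mod G H\<close> are thus
  inherited from the centre of the quotient.\<close>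

lemma central_mod_eq_Union: "central_mod G H = \<Union> (center (G Mod H))"
  using factgroup_subgroup_union_char[OF group.subgroup_center[OF factorgroup_is_group]]
    central_mod_iff by blast

lemma normal_central_mod: "central_mod G H \<lhd> G"
  unfolding central_mod_eq_Union
  by (rule factgroup_subgroup_union_normal[OF group.normal_center[OF factorgroup_is_group]])

lemma subset_Union_subgroup_FactGroup:
  assumes "subgroup A (G Mod H)" shows "H \<subseteq> \<Union> A"
  using subgroup.one_closed[OF assms] by auto

lemma card_Union_subgroup_FactGroup:
  assumes "subgroup A (G Mod H)" shows "card (\<Union> A) = card A * card H"
proof -
  have "subgroup (\<Union>A) G" by (rule factgroup_subgroup_union_subgroup[OF assms])
  then interpret U: group "G\<lparr>carrier := \<Union>A\<rparr>" by (rule subgroup.subgroup_is_group) (rule is_group)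
  have "subgroup H (G\<lparr>carrier := \<Union>A\<rparr>)"
    using subgroup_incl[OF is_subgroup \<open>subgroup (\<Union>A) G\<close> subset_Union_subgroup_FactGroup[OF assms]] .
  from U.lagrange[OF this] factgroup_subgroup_union_factor[OF assms]
  show ?thesis by (simp add: order_def)
qed

lemma subset_central_mod: "H \<subseteq> central_mod G H"
  unfolding central_mod_eq_Union
  by (rule subset_Union_subgroup_FactGroup[OF group.subgroup_center[OF factorgroup_is_group]])

lemma card_central_mod: "card (central_mod G H) = card (center (G Mod H)) * card H"
  unfolding central_mod_eq_Union
  by (rule card_Union_subgroup_FactGroup[OF group.subgroup_center[OF factorgroup_is_group]])

lemma central_mod_eq_carrier_if_cyclic:
  assumes a: "a \<in> carrier G"
    and gen: "\<And>x. x \<in> carrier G \<Longrightarrow> \<exists>i::nat. \<exists>c \<in> central_mod G H. x = a [^] i \<otimes> c"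
  shows "central_mod G H = carrier G"
proof -
  interpret Q: group "G Mod H" by (rule factorgroup_is_group)
  have "center (G Mod H) = carrier (G Mod H)"
  proof (rule Q.center_eq_carrier_if_cyclic_mod_center)
    show "H #> a \<in> carrier (G Mod H)" using a by (auto simp: carrier_FactGroup)
    fix V assume "V \<in> carrier (G Mod H)"
    then obtain x where x: "x \<in> carrier G" "V = H #> x" by (auto simp: carrier_FactGroup)
    then obtain i :: nat and c where c: "c \<in> central_mod G H" "x = a [^] i \<otimes> c" using gen by blast
    then have "V = (H #> a) [^]\<^bsub>G Mod H\<^esub> i \<otimes>\<^bsub>G Mod H\<^esub> (H #> c)"
      using a x central_mod_iff by (simp add: FactGroup_pow rcos_sum)
    then show "\<exists>i::nat. \<exists>c\<in>center (G Mod H). V = (H #> a) [^]\<^bsub>G Mod H\<^esub> i \<otimes>\<^bsub>G Mod H\<^esub> c"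
      using c central_mod_iff by blast
  qed
  then show ?thesis
    using central_mod_iff by (auto simp: carrier_FactGroup)
qed

end

lemma (in group) lcs_Suc_subset_one_iff:
  "lcs G (Suc k) \<subseteq> {\<one>} \<longleftrightarrow> lcs G k \<subseteq> center G"
  using lcs_Suc_subset_iff[OF triv_subgroup subgroup.subset[OF subgroup_lcs]]
    center_eq_central_mod by simp

text \<open>First isomorphism theorem combined with Lagrange; the target is first cut down to the
  image, so that \<open>h\<close> becomes surjective.\<close>

lemma (in group_hom) card_image_mult_card_kernel:
  "card (h ` carrier G) * card (kernel G H h) = order G"
proof -
  let ?I = "H\<lparr>carrier := h ` carrier G\<rparr>"
  have "group ?I"
    using H.subgroup_imp_group img_is_subgroup by blast
  then interpret I: group_hom G ?I h
    using homh by (simp add: group_hom_def group_hom_axioms_def hom_def Pi_iff)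
  have "kernel G ?I h = kernel G H h" by (simp add: kernel_def)
  then have "(\<lambda>V. the_elem (h ` V)) \<in> iso (G Mod kernel G H h) ?I"
    using I.FactGroup_iso_set by simp
  then have "bij_betw (\<lambda>V. the_elem (h ` V)) (carrier (G Mod kernel G H h)) (h ` carrier G)"
    by (simp add: iso_def)
  then have "card (rcosets\<^bsub>G\<^esub> kernel G H h) = card (h ` carrier G)"
    using bij_betw_same_card by (fastforce simp: FactGroup_def)
  with G.lagrange[OF subgroup_kernel] show ?thesis by simp
qed

section \<open>Finite p-groups\<close>

locale p_group = group G for G (structure) +
  fixes p n :: nat
  assumes prime_p: "Factorial_Ring.prime p" and order_eq: "order G = p ^ n"
begin

lemma p_gt_1: "1 < p"
  using prime_p by (rule prime_gt_1_nat)

lemma finite_carrier: "finite (carrier G)"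
  using order_gt_0_iff_finite order_eq p_gt_1 by simp

lemma card_carrier: "card (carrier G) = p ^ n"
  using order_eq by (simp add: order_def)

lemma finite_subgroup: "subgroup H G \<Longrightarrow> finite H"
  using finite_carrier finite_subset subgroup.subset by metis

lemma dvd_power_p: "d dvd p ^ m \<Longrightarrow> \<exists>k\<le>m. d = p ^ k"
  using divides_primepow_nat[OF prime_p] by blast

lemma card_subgroup: "subgroup H G \<Longrightarrow> \<exists>k\<le>n. card H = p ^ k"
  using lagrange[of H] order_eq dvd_power_p by (metis dvd_triv_right)

text \<open>Both orders are powers of \<open>p\<close>, so a strict inclusion costs a full factor
  \<open>p\<close>. Most size estimates below rest on this.\<close>

lemma card_subgroup_psubset:
  assumes "subgroup H G" "subgroup K G" "H \<subset> K"
  shows "p * card H \<le> card K"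
proof -
  obtain i j where ij: "card H = p ^ i" "card K = p ^ j"
    using card_subgroup assms by meson
  have "card H < card K"
    using assms finite_subgroup psubset_card_mono by blast
  then have "Suc i \<le> j"
    using ij p_gt_1 by simp
  then have "p ^ Suc i \<le> p ^ j"
    using p_gt_1 by (intro power_increasing) auto
  then show ?thesis using ij by simp
qed

lemma ord_eq_power:
  assumes "a \<in> carrier G" shows "\<exists>k\<le>n. ord a = p ^ k"
  using ord_dvd_group_order[OF assms] order_eq dvd_power_p by metis

lemma p_group_FactGroup:
  assumes "N \<lhd> G"
  obtains k where "p_group (G Mod N) p k" "p ^ k * card N = p ^ n"
proof -
  interpret N: normal N G by fact
  have l: "order (G Mod N) * card N = p ^ n"
    using lagrange[OF N.is_subgroup] order_eq by (simp add: order_def FactGroup_def)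
  then obtain k where "order (G Mod N) = p ^ k"
    using dvd_power_p by (metis dvd_triv_left)
  with l that show ?thesis
    using N.factorgroup_is_group prime_p by (simp add: p_group_def p_group_axioms_def)
qed

text \<open>Class equation modulo \<open>p\<close>: if the centre were trivial, every conjugacy
  class other than that of \<open>\<one>\<close> would have size divisible by \<open>p\<close>, and
  then \<open>p ^ n\<close> would be 1 modulo \<open>p\<close>.\<close>

lemma center_nontrivial:
  assumes "0 < n" shows "center G \<noteq> {\<one>}"
proof
  assume triv: "center G = {\<one>}"
  define \<phi> where "\<phi> = (\<lambda>g. \<lambda>h \<in> carrier G. g \<otimes> h \<otimes> inv g)"
  interpret A: group_action G "carrier G" \<phi>
    unfolding \<phi>_def by (rule action_by_conjugation)
  have orb_mem: "x \<in> orbit G \<phi> x" if "x \<in> carrier G" for x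
    using A.orbit_refl that by blast
  have one: "orbit G \<phi> \<one> = {\<one>}"
  proof
    show "orbit G \<phi> \<one> \<subseteq> {\<one>}" unfolding orbit_def \<phi>_def by auto
    show "{\<one>} \<subseteq> orbit G \<phi> \<one>" using orb_mem[OF one_closed] by blast
  qed
  define Orb where "Orb = orbits G (carrier G) \<phi>"
  have Orb: "Orb = orbit G \<phi> ` carrier G"
    unfolding Orb_def orbits_def by blast
  have dvd: "p dvd card w" if w: "w \<in> Orb - {{\<one>}}" for w
  proof -
    obtain x where x: "x \<in> carrier G" "w = orbit G \<phi> x"
      using w unfolding Orb by blast
    have "card w dvd p ^ n"
      unfolding order_eq[symmetric] x(2) A.orbit_stabilizer_theorem[OF x(1), symmetric]
      by (rule dvd_triv_left)
    then obtain k where k: "card w = p ^ k" using dvd_power_p by blast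
    \<comment> \<open>An orbit of size 1 consists of a central element, so it could only be the
      excluded orbit of \<open>\<one>\<close>.\<close>
    show ?thesis
    proof (cases "k = 0")
      case True
      with k have "card w = 1" by simp
      then have wx: "w = {x}"
        using orb_mem[OF x(1)] unfolding x(2)[symmetric] by (auto simp: card_1_singleton_iff)
      have "g \<otimes> x = x \<otimes> g" if g: "g \<in> carrier G" for g
      proof -
        have "\<phi> g x \<in> w" unfolding x(2) orbit_def using g by blast
        then have "g \<otimes> x \<otimes> inv g = x" using wx x(1) by (simp add: \<phi>_def)
        then show ?thesis using g x(1) by (metis inv_solve_right' m_closed)
      qed
      then have "x \<in> center G"
        using x(1) by (simp add: center_def)
      then show ?thesis using triv w wx by simp
    next
      case False
      then show ?thesis using k by simp
    qed
  qed
  have fin: "finite Orb"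
    unfolding Orb using finite_carrier by (rule finite_imageI)
  have mem: "{\<one>} \<in> Orb"
    unfolding Orb using one one_closed by (metis imageI)
  have "card (carrier G) = (\<Sum>w\<in>Orb. card w)"
    using A.disjoint_sum[OF finite_carrier, of "\<lambda>_. 1::nat"] unfolding Orb_def by simp
  also have "\<dots> = 1 + (\<Sum>w\<in>Orb - {{\<one>}}. card w)"
    using sum.remove[OF fin mem, of card] by simp
  finally have "p ^ n = 1 + (\<Sum>w\<in>Orb - {{\<one>}}. card w)"
    using card_carrier by simp
  moreover have "p dvd (\<Sum>w\<in>Orb - {{\<one>}}. card w)"
    using dvd by (rule dvd_sum)
  moreover have "p dvd p ^ n" using assms by simp
  ultimately have "p dvd 1" by (metis dvd_add_left_iff)
  then show False using p_gt_1 by simp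
qed

text \<open>The quotient by a proper normal subgroup is a nontrivial p-group and so has a nontrivial
  centre.\<close>

lemma subset_central_mod_strict:
  assumes "N \<lhd> G" "N \<noteq> carrier G"
  shows "N \<subset> central_mod G N"
proof -
  interpret N: normal N G by fact
  obtain k where k: "p_group (G Mod N) p k" "p ^ k * card N = p ^ n"
    using p_group_FactGroup[OF assms(1)] .
  then interpret Q: p_group "G Mod N" p k by simp
  have "k \<noteq> 0"
  proof
    assume "k = 0"
    then have "card N = card (carrier G)" using k card_carrier by simp
    then show False
      using assms(2) N.subset finite_carrier card_subset_eq by blast
  qed
  then have "center (G Mod N) \<noteq> {N}" using Q.center_nontrivial by simp
  moreover have "N \<in> center (G Mod N)"
    using subgroup.one_closed[OF Q.subgroup_center] by simp
  ultimately obtain V where V: "V \<in> center (G Mod N)" "V \<noteq> N" by blast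
  then obtain x where x: "x \<in> carrier G" "V = N #> x"
    using subgroup.subset[OF Q.subgroup_center] by (auto simp: carrier_FactGroup)
  then have "x \<in> central_mod G N" using V N.central_mod_iff by simp
  moreover have "x \<notin> N" using V(2) x(2) coset_join2[OF x(1) N.is_subgroup] by auto
  ultimately show ?thesis using N.subset_central_mod by blast
qed

text \<open>The quotient has order \<open>p ^ Suc k\<close>, and the order of the coset of
  \<open>a\<close> is a power of \<open>p\<close> that does not divide \<open>p ^ k\<close>. It is
  therefore the full order, and the coset generates.\<close>

lemma cyclic_FactGroup:
  assumes N: "N \<lhd> G" "card N * p ^ Suc k = p ^ n"
    and a: "a \<in> carrier G" "a [^] (p ^ k) \<notin> N" and x: "x \<in> carrier G"
  shows "\<exists>i::nat. \<exists>c\<in>N. x = a [^] i \<otimes> c"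
proof -
  interpret N: normal N G by fact
  obtain l where l: "p_group (G Mod N) p l" "p ^ l * card N = p ^ n"
    using p_group_FactGroup[OF N(1)] .
  then interpret Q: p_group "G Mod N" p l by simp
  have "card N \<noteq> 0" using l p_gt_1 by (metis mult_0_right power_not_zero not_one_less_zero)
  then have "p ^ l = p ^ Suc k" using N(2) l(2) by (metis mult.commute mult_right_cancel)
  then have l: "l = Suc k" using p_gt_1 power_inject_exp by blast
  let ?a = "N #> a"
  have a': "?a \<in> carrier (G Mod N)" using a by (auto simp: carrier_FactGroup)
  have "?a [^]\<^bsub>G Mod N\<^esub> (p ^ k) \<noteq> \<one>\<^bsub>G Mod N\<^esub>"
    using a coset_join1[OF _ _ N.is_subgroup] by (auto simp: N.FactGroup_pow)
  then have nd: "\<not> Q.ord ?a dvd p ^ k" using Q.pow_eq_id[OF a'] by simp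
  obtain j where j: "j \<le> l" "Q.ord ?a = p ^ j" using Q.ord_eq_power[OF a'] by blast
  have "j = Suc k"
  proof (rule ccontr)
    assume "j \<noteq> Suc k"
    then have "j \<le> k" using j l by simp
    then show False using nd j by (simp add: le_imp_power_dvd)
  qed
  then have "card (generate (G Mod N) {?a}) = card (carrier (G Mod N))"
    using Q.generate_pow_card[OF a'] j l Q.card_carrier by simp
  then have "generate (G Mod N) {?a} = carrier (G Mod N)"
    using Q.generate_incl[of "{?a}"] a' Q.finite_carrier card_subset_eq by blast
  then have "N #> x \<in> generate (G Mod N) {?a}" using x by (auto simp: carrier_FactGroup)
  then obtain i :: nat where "N #> x = ?a [^]\<^bsub>G Mod N\<^esub> i"
    unfolding Q.generate_pow_on_finite_carrier[OF Q.finite_carrier a'] by blast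
  then show ?thesis using N.coset_pow_mult[OF a(1) x] by blast
qed

text \<open>If \<open>central_mod G N\<close> were proper, its index would be exactly
  \<open>p\<close>, and any element outside would generate \<open>G\<close> modulo it. A group that
  is cyclic modulo its centre is abelian, applied to \<open>G/N\<close>.\<close>

lemma central_mod_eq_carrier_if_index_le:
  assumes "N \<lhd> G" "p ^ n \<le> card (central_mod G N) * p"
  shows "central_mod G N = carrier G"
proof (rule ccontr)
  assume ne: "central_mod G N \<noteq> carrier G"
  interpret N: normal N G by fact
  interpret C: normal "central_mod G N" G by (rule N.normal_central_mod)
  obtain a where a: "a \<in> carrier G" "a \<notin> central_mod G N"
    using ne C.subset by blast
  have "p * card (central_mod G N) \<le> p ^ n"
    using card_subgroup_psubset[OF C.is_subgroup subgroup_self] ne C.subset card_carrier by auto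
  then have "card (central_mod G N) * p ^ Suc 0 = p ^ n"
    using assms(2) by (simp add: mult.commute)
  then have "\<exists>i::nat. \<exists>c\<in>central_mod G N. x = a [^] i \<otimes> c" if "x \<in> carrier G" for x
    using cyclic_FactGroup[OF N.normal_central_mod, of 0 a x] a that by simp
  then show False
    using N.central_mod_eq_carrier_if_cyclic[OF a(1)] ne by blast
qed

text \<open>Groups of order at most \<open>p\<^sup>2\<close> are abelian: the centre of
  \<open>G/N\<close> is nontrivial unless \<open>N = G\<close>, so its preimage has index at most
  \<open>p\<close>.\<close>

lemma derived_subset_if_index_le_p_squared:
  assumes "N \<lhd> G" "p ^ n \<le> card N * p\<^sup>2"
  shows "derived G (carrier G) \<subseteq> N"
proof (cases "N = carrier G")
  case True
  then show ?thesis using derived_in_carrier by blast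
next
  case False
  interpret N: normal N G by fact
  have "p * card N \<le> card (central_mod G N)"
    using card_subgroup_psubset[OF N.is_subgroup _ subset_central_mod_strict[OF assms(1) False]]
      normal_imp_subgroup[OF N.normal_central_mod] by blast
  then have "p * (p * card N) \<le> p * card (central_mod G N)"
    by (rule mult_le_mono2)
  moreover have "p ^ n \<le> p * (p * card N)"
    using assms(2) by (simp add: power2_eq_square ac_simps)
  ultimately have "p ^ n \<le> card (central_mod G N) * p"
    by (simp only: mult.commute[of _ p])
  then have "central_mod G N = carrier G"
    by (rule central_mod_eq_carrier_if_index_le[OF assms(1)])
  then show ?thesis using central_mod_eq_carrier_iff[OF N.is_subgroup] by simp
qed

text \<open>Sylow's theorem provides a subgroup of order \<open>p\<close> in \<open>G/B\<close>, and
  its preimage is the required group.\<close>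

lemma supergroup_index_p:
  assumes "B \<lhd> G" "B \<noteq> carrier G"
  obtains B' where "subgroup B' G" "B \<subseteq> B'" "card B' = p * card B"
proof -
  interpret B: normal B G by fact
  obtain k where k: "p_group (G Mod B) p k" "p ^ k * card B = p ^ n"
    using p_group_FactGroup[OF assms(1)] .
  then interpret Q: p_group "G Mod B" p k by simp
  have "k \<noteq> 0"
  proof
    assume "k = 0"
    then have "card B = card (carrier G)" using k card_carrier by simp
    then show False
      using assms(2) B.subset finite_carrier card_subset_eq by blast
  qed
  then obtain m where m: "k = Suc m" using not0_implies_Suc by blast
  obtain A where A: "subgroup A (G Mod B)" "card A = p ^ 1"
    using sylow_thm[OF prime_p Q.is_group, of 1 "p ^ m"] Q.order_eq m Q.finite_carrier by auto
  show ?thesis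
    using that[OF B.factgroup_subgroup_union_subgroup[OF A(1)] B.subset_Union_subgroup_FactGroup[OF A(1)]]
      B.card_Union_subgroup_FactGroup[OF A(1)] A(2) by simp
qed

end

section \<open>Homomorphisms out of cyclic quotients\<close>

lemma (in group) hom_from_cyclic_FactGroup:
  assumes N: "N \<lhd> G" and g: "g \<in> carrier G"
    and g_pow: "\<And>i::nat. g [^] i \<in> N \<Longrightarrow> m dvd i"
    and gen: "\<And>x. x \<in> carrier G \<Longrightarrow> \<exists>i::nat. \<exists>c\<in>N. x = g [^] i \<otimes> c"
    and z: "z \<in> carrier G" "z [^] m = \<one>"
  obtains h where "h \<in> hom G G" "\<And>i::nat. \<And>c. c \<in> N \<Longrightarrow> h (g [^] i \<otimes> c) = z [^] i"
proof -
  interpret N: normal N G by fact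
  \<comment> \<open>Well-definedness: two representations of one element differ by a power of
    \<open>g\<close> in \<open>N\<close>, hence by a multiple of \<open>m\<close> in the exponent,
    which \<open>z\<close> does not see. Exponents are natural numbers, so the case
    \<open>i \<le> j\<close> comes first.\<close>
  have le: "z [^] i = z [^] j"
    if ij: "i \<le> j" and cd: "c \<in> N" "d \<in> N" and eq: "g [^] i \<otimes> c = g [^] j \<otimes> d" for i j :: nat and c d
  proof -
    have cd': "c \<in> carrier G" "d \<in> carrier G" using cd by auto
    have "g [^] j = g [^] i \<otimes> g [^] (j - i)"
      using ij g by (simp add: nat_pow_mult)
    then have "g [^] i \<otimes> c = g [^] i \<otimes> (g [^] (j - i) \<otimes> d)"
      using eq g cd' by (simp add: m_assoc)
    then have "c = g [^] (j - i) \<otimes> d"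
      using g cd' by simp
    then have "g [^] (j - i) = c \<otimes> inv d"
      using g cd' by (simp add: inv_solve_right)
    then have "m dvd j - i" using g_pow cd by auto
    then obtain k where "j - i = m * k" by blast
    then have "z [^] (j - i) = \<one>" using z by (simp flip: nat_pow_pow)
    moreover have "z [^] j = z [^] i \<otimes> z [^] (j - i)"
      using ij z by (simp add: nat_pow_mult)
    ultimately show ?thesis using z by simp
  qed
  have wd: "z [^] i = z [^] j"
    if "c \<in> N" "d \<in> N" "g [^] i \<otimes> c = g [^] j \<otimes> d" for i j :: nat and c d
    using le[of i j c d] le[of j i d c] that by (metis nat_le_linear)
  define h where "h x = z [^] (SOME i::nat. \<exists>c\<in>N. x = g [^] i \<otimes> c)" for x
  have h: "h (g [^] i \<otimes> c) = z [^] i" if c: "c \<in> N" for i :: nat and c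
  proof -
    have "\<exists>d\<in>N. g [^] i \<otimes> c = g [^] (SOME j::nat. \<exists>d\<in>N. g [^] i \<otimes> c = g [^] j \<otimes> d) \<otimes> d"
      using c by (intro someI_ex[of "\<lambda>j::nat. \<exists>d\<in>N. g [^] i \<otimes> c = g [^] j \<otimes> d"]) blast
    then obtain d where d: "d \<in> N"
      "g [^] i \<otimes> c = g [^] (SOME j::nat. \<exists>d\<in>N. g [^] i \<otimes> c = g [^] j \<otimes> d) \<otimes> d" by blast
    show ?thesis unfolding h_def using wd[OF c d] by simp
  qed
  have "h \<in> hom G G"
  proof (rule homI)
    fix x assume "x \<in> carrier G"
    then show "h x \<in> carrier G" unfolding h_def using z by simp
  next
    fix x y assume xy: "x \<in> carrier G" "y \<in> carrier G"
    obtain i :: nat and c where c: "c \<in> N" "x = g [^] i \<otimes> c" using gen xy by blast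
    obtain j :: nat and d where d: "d \<in> N" "y = g [^] j \<otimes> d" using gen xy by blast
    have cd': "c \<in> carrier G" "d \<in> carrier G" using c d by auto
    \<comment> \<open>The element that \<open>c\<close> becomes when it is moved to the right past
      \<open>g [^] j\<close>; normality keeps it in \<open>N\<close>.\<close>
    define e where "e = inv (g [^] j) \<otimes> c \<otimes> g [^] j"
    have e: "e \<in> N" unfolding e_def using c g by (intro N.inv_op_closed1) auto
    have "g [^] j \<otimes> e = c \<otimes> g [^] j"
      unfolding e_def using g cd' by (simp add: m_assoc[symmetric])
    then have "x \<otimes> y = g [^] i \<otimes> (g [^] j \<otimes> e) \<otimes> d"
      using c d cd' g by (simp add: m_assoc)
    also have "\<dots> = g [^] (i + j) \<otimes> (e \<otimes> d)"
      using cd' g N.mem_carrier[OF e] by (simp add: m_assoc flip: nat_pow_mult)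
    finally have "h (x \<otimes> y) = z [^] (i + j)" using h e d by simp
    also have "\<dots> = h x \<otimes> h y" using h c d z by (simp add: nat_pow_mult)
    finally show "h (x \<otimes> y) = h x \<otimes> h y" .
  qed
  with h that show ?thesis by blast
qed

section \<open>Bounds on the commutator subgroup, and cyclic quotients of p-groups\<close>

context p_group
begin

text \<open>
  A normal subgroup \<open>M\<close> containing \<open>N\<close> and maximal with \<open>\<not> G' \<subseteq> M\<close> has \<open>G' \<subseteq> central_mod G M\<close>, so that
  \<open>G\<close> is cyclic modulo \<open>central_mod G M\<close> and hence abelian modulo \<open>M\<close>.
\<close>
lemma derived_subset_if_cyclic_abelianization:
  assumes N: "N \<lhd> G" and a: "a \<in> carrier G"
    and gen: "\<And>x. x \<in> carrier G \<Longrightarrow> \<exists>i::nat. \<exists>c \<in> derived G (carrier G) <#> N. x = a [^] i \<otimes> c"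
  shows "derived G (carrier G) \<subseteq> N"
proof (rule ccontr)
  let ?D = "derived G (carrier G)"
  assume *: "\<not> ?D \<subseteq> N"
  let ?S = "{M. M \<lhd> G \<and> N \<subseteq> M \<and> \<not> ?D \<subseteq> M}"
  have "?S \<subseteq> Pow (carrier G)"
    using subgroup.subset[OF normal_imp_subgroup] by blast
  then have "finite ?S" using finite_carrier finite_subset by blast
  moreover have "N \<in> ?S" using N * by blast
  ultimately obtain M where M: "M \<in> ?S" "\<forall>M'\<in>?S. M \<subseteq> M' \<longrightarrow> M = M'"
    using finite_has_maximal[of ?S] by blast
  then interpret M: normal M G by simp
  have "M \<noteq> carrier G" using M derived_in_carrier[of "carrier G"] by auto
  then have sub: "M \<subset> central_mod G M" using subset_central_mod_strict M by simp
  then have "central_mod G M \<notin> ?S" using M by blast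
  then have D: "?D \<subseteq> central_mod G M" using M.normal_central_mod sub M by auto
  interpret C: normal "central_mod G M" G by (rule M.normal_central_mod)
  have "?D <#> N \<subseteq> central_mod G M"
  proof
    fix u assume "u \<in> ?D <#> N"
    then obtain d b where "d \<in> ?D" "b \<in> N" "u = d \<otimes> b" by (auto simp: set_mult_def)
    then show "u \<in> central_mod G M" using D sub M(1) by blast
  qed
  then have "central_mod G M = carrier G"
    using M.central_mod_eq_carrier_if_cyclic[OF a] gen by (meson subsetD)
  then show False using central_mod_eq_carrier_iff[OF M.is_subgroup] M by simp
qed

text \<open>As \<open>G/Z\<close> is abelian, commutation with a noncentral \<open>a\<close> is a
  homomorphism. Its kernel, the centralizer of \<open>a\<close>, lies strictly between
  \<open>Z\<close> and \<open>G\<close>, so its image \<open>H\<close> has order \<open>p\<close>.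
  Modulo \<open>H\<close> both \<open>Z\<close> and \<open>a\<close> are central, so the centre of
  \<open>G/H\<close> has index at most \<open>p\<close> and \<open>G/H\<close> is abelian.\<close>

lemma derived_bound_if_center_index_p_squared:
  assumes card: "card (center G) * p\<^sup>2 = p ^ n"
  obtains H where "subgroup H G" "card H = p" "central_mod G H = carrier G"
proof -
  let ?Z = "center G"
  interpret Z: normal ?Z G by (rule normal_center)
  have "derived G (carrier G) \<subseteq> ?Z"
    using derived_subset_if_index_le_p_squared[OF normal_center] card by simp
  then have comm: "x \<otimes> y \<otimes> inv x \<otimes> inv y \<in> ?Z" if "x \<in> carrier G" "y \<in> carrier G" for x y
    using commutator_mem_derived that by blast
  have "?Z \<noteq> carrier G"
  proof
    assume "?Z = carrier G"
    then have "p ^ n * p\<^sup>2 = p ^ n" using card card_carrier by simp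
    then have "p\<^sup>2 = 1" using p_gt_1 by simp
    then show False using p_gt_1 by simp
  qed
  then obtain a where a: "a \<in> carrier G" "a \<notin> ?Z" using Z.subset by blast
  define h where "h x = a \<otimes> x \<otimes> inv a \<otimes> inv x" for x
  have hc: "h x \<in> carrier G" "h x \<in> ?Z" if "x \<in> carrier G" for x
    using that a comm by (auto simp: h_def)
  have h_hom: "h \<in> hom G G"
  proof (rule homI)
    fix x y assume xy: "x \<in> carrier G" "y \<in> carrier G"
    have cancel: "inv a \<otimes> (a \<otimes> w) = w" if "w \<in> carrier G" for w
      using that a by (simp flip: m_assoc)
    have "h (x \<otimes> y) = a \<otimes> x \<otimes> inv a \<otimes> h y \<otimes> inv x"
      using xy a by (simp add: h_def m_assoc inv_mult_group cancel)
    also have "\<dots> = a \<otimes> x \<otimes> inv a \<otimes> (h y \<otimes> inv x)"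
      using xy a hc by (simp add: m_assoc)
    \<comment> \<open>The homomorphism property rests on the values of \<open>h\<close> being
      central.\<close>
    also have "h y \<otimes> inv x = inv x \<otimes> h y"
      using hc(2)[OF xy(2)] inv_closed[OF xy(1)] unfolding center_def by blast
    also have "a \<otimes> x \<otimes> inv a \<otimes> (inv x \<otimes> h y) = h x \<otimes> h y"
      using xy a hc by (simp add: h_def m_assoc)
    finally show "h (x \<otimes> y) = h x \<otimes> h y" .
  qed (use hc in simp)
  interpret h: group_hom G G h
    using h_hom by (simp add: group_hom_def group_hom_axioms_def is_group)
  let ?K = "kernel G G h"
  have K: "?K = {x \<in> carrier G. a \<otimes> x = x \<otimes> a}"
    unfolding kernel_def h_def using commutator_eq_one_iff[OF a(1)] by blast
  have sK: "subgroup ?K G" by (rule h.subgroup_kernel)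
  have "?Z \<subseteq> ?K"
  proof
    fix u assume "u \<in> ?Z"
    then have "u \<in> carrier G" "u \<otimes> a = a \<otimes> u" using a(1) unfolding center_def by blast+
    then show "u \<in> ?K" unfolding K by simp
  qed
  moreover have "a \<in> ?K" unfolding K using a by simp
  ultimately have "?Z \<subset> ?K" using a by blast
  then have K1: "p * card ?Z \<le> card ?K"
    using card_subgroup_psubset[OF Z.is_subgroup sK] by simp
  have "?K \<noteq> carrier G"
  proof
    assume "?K = carrier G"
    then have "a \<otimes> x = x \<otimes> a" if "x \<in> carrier G" for x using that unfolding K by blast
    then show False using a unfolding center_def by blast
  qed
  then have "?K \<subset> carrier G" using subgroup.subset[OF sK] by blast
  then have K2: "p * card ?K \<le> p ^ n"
    using card_subgroup_psubset[OF sK subgroup_self] card_carrier by simp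
  have pz: "p * (p * card ?Z) = p ^ n" using card by (simp add: power2_eq_square ac_simps)
  have "p * (p * card ?Z) \<le> p * card ?K" using K1 by (rule mult_le_mono2)
  then have Kc: "p * card ?K = p ^ n" using K2 pz by simp
  have "card (h ` carrier G) * card ?K = p * card ?K"
    using h.card_image_mult_card_kernel Kc order_eq by simp
  moreover have "card ?K \<noteq> 0" using Kc p_gt_1 by (metis mult_0_right power_not_zero not_one_less_zero)
  ultimately have cH: "card (h ` carrier G) = p" by simp
  let ?H = "h ` carrier G"
  have sH: "subgroup ?H G" by (rule h.img_is_subgroup)
  have HZ: "?H \<subseteq> ?Z" using hc by auto
  have nH: "?H \<lhd> G"
  proof (rule normal_invI[OF sH])
    fix x u assume xu: "x \<in> carrier G" "u \<in> ?H"
    then have "u \<in> ?Z" "u \<in> carrier G" using HZ Z.subset by auto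
    then have "x \<otimes> u = u \<otimes> x" using xu center_commute by metis
    then have "x \<otimes> u \<otimes> inv x = u" using xu \<open>u \<in> carrier G\<close> by (simp add: m_assoc)
    then show "x \<otimes> u \<otimes> inv x \<in> ?H" using xu by simp
  qed
  then interpret H: normal ?H G .
  have "?Z \<subseteq> central_mod G ?H"
  proof
    fix u assume u: "u \<in> ?Z"
    then have uc: "u \<in> carrier G" using Z.subset by blast
    have "x \<otimes> u \<otimes> inv x \<otimes> inv u = \<one>" if "x \<in> carrier G" for x
      using center_commute[OF u that] commutator_eq_one_iff[OF that uc] by simp
    then show "u \<in> central_mod G ?H"
      using uc H.one_closed by (auto simp: central_mod_def)
  qed
  moreover have "a \<in> central_mod G ?H"
  proof -
    have "x \<otimes> a \<otimes> inv x \<otimes> inv a \<in> ?H" if x: "x \<in> carrier G" for x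
    proof -
      \<comment> \<open>Exchanging the two entries inverts a commutator, and \<open>H\<close>
        consists of the commutators with \<open>a\<close> as first entry.\<close>
      have "x \<otimes> a \<otimes> inv x \<otimes> inv a = inv (h x)"
        using x a(1) unfolding h_def by (simp add: inv_mult_group m_assoc)
      then show ?thesis using subgroup.m_inv_closed[OF sH imageI[OF x]] by simp
    qed
    then show ?thesis using a(1) by (simp add: central_mod_def)
  qed
  ultimately have "?Z \<subset> central_mod G ?H" using a by blast
  then have "p * card ?Z \<le> card (central_mod G ?H)"
    using card_subgroup_psubset[OF Z.is_subgroup normal_imp_subgroup[OF H.normal_central_mod]] by simp
  then have "p * (p * card ?Z) \<le> p * card (central_mod G ?H)" by (rule mult_le_mono2)
  then have "central_mod G ?H = carrier G"
    using central_mod_eq_carrier_if_index_le[OF nH] pz by (simp add: mult.commute)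
  with that sH cH show ?thesis by blast
qed

text \<open>The preceding lemma in \<open>G/N\<close>, with its subgroup of order \<open>p\<close>
  pulled back. It is applied to the first two terms of the upper central series.\<close>

lemma derived_bound_if_central_mod_index_p_squared:
  assumes N: "N \<lhd> G" and card: "card (central_mod G N) * p\<^sup>2 = p ^ n"
  obtains H where "subgroup H G" "N \<subseteq> H" "card H = p * card N" "derived G (carrier G) \<subseteq> H"
proof -
  interpret N: normal N G by fact
  obtain k where k: "p_group (G Mod N) p k" "p ^ k * card N = p ^ n"
    using p_group_FactGroup[OF N] .
  then interpret Q: p_group "G Mod N" p k by simp
  have "card N \<noteq> 0" using k p_gt_1 by (metis mult_0_right power_not_zero not_one_less_zero)
  moreover have "(card (center (G Mod N)) * p\<^sup>2) * card N = p ^ k * card N"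
    using card k N.card_central_mod by (simp add: ac_simps)
  ultimately have "card (center (G Mod N)) * p\<^sup>2 = p ^ k" by simp
  then obtain A where A: "subgroup A (G Mod N)" "card A = p" "central_mod (G Mod N) A = carrier (G Mod N)"
    using Q.derived_bound_if_center_index_p_squared by blast
  have U: "\<Union>A = {x \<in> carrier G. N #> x \<in> A}" by (rule N.factgroup_subgroup_union_char[OF A(1)])
  have sU: "subgroup (\<Union>A) G" by (rule N.factgroup_subgroup_union_subgroup[OF A(1)])
  have "central_mod G (\<Union>A) = carrier G"
  proof -
    have "x \<otimes> y \<otimes> inv x \<otimes> inv y \<in> \<Union>A" if xy: "x \<in> carrier G" "y \<in> carrier G" for x y
    proof -
      have c: "N #> x \<in> carrier (G Mod N)" "N #> y \<in> carrier (G Mod N)"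
        using xy by (auto simp: carrier_FactGroup)
      have i: "inv\<^bsub>G Mod N\<^esub> (N #> u) = N #> inv u" if "u \<in> carrier G" for u
        using that N.inv_FactGroup N.rcos_inv by (auto simp: carrier_FactGroup)
      have "N #> (x \<otimes> y \<otimes> inv x \<otimes> inv y) =
         (N #> x) \<otimes>\<^bsub>G Mod N\<^esub> (N #> y) \<otimes>\<^bsub>G Mod N\<^esub> inv\<^bsub>G Mod N\<^esub> (N #> x) \<otimes>\<^bsub>G Mod N\<^esub> inv\<^bsub>G Mod N\<^esub> (N #> y)"
        using xy by (simp add: i N.rcos_sum)
      also have "\<dots> \<in> A" using A(3) c by (auto simp: central_mod_def)
      finally show ?thesis using U xy by simp
    qed
    then show ?thesis by (auto simp: central_mod_def)
  qed
  then have "derived G (carrier G) \<subseteq> \<Union>A" using central_mod_eq_carrier_iff[OF sU] by simp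
  moreover have "card (\<Union>A) = p * card N"
    using N.card_Union_subgroup_FactGroup[OF A(1)] A(2) by simp
  ultimately show ?thesis
    using that[OF sU N.subset_Union_subgroup_FactGroup[OF A(1)]] by blast
qed

text \<open>Let \<open>g\<close> have maximal order. If \<open>g\<close> does not generate, there is
  an element \<open>b\<close> of order \<open>p\<close> outside the cyclic group \<open>?C\<close>
  of \<open>g\<close>; the group generated by \<open>b\<close> then meets \<open>?C\<close>
  trivially, although \<open>y\<close> lies in both.\<close>

lemma cyclic_if_least_nontrivial_subgroup:
  assumes comm: "\<And>u v. u \<in> carrier G \<Longrightarrow> v \<in> carrier G \<Longrightarrow> u \<otimes> v = v \<otimes> u"
    and y: "y \<in> carrier G" "y \<noteq> \<one>"
    and least: "\<And>H. subgroup H G \<Longrightarrow> H \<noteq> {\<one>} \<Longrightarrow> y \<in> H"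
  obtains g where "g \<in> carrier G" "generate G {g} = carrier G"
proof -
  have "finite (ord ` carrier G)" "ord ` carrier G \<noteq> {}"
    using finite_carrier by auto
  then have "Max (ord ` carrier G) \<in> ord ` carrier G" by (rule Max_in)
  then obtain g where g: "g \<in> carrier G" "ord g = Max (ord ` carrier G)" by force
  obtain j where j: "ord g = p ^ j" using ord_eq_power[OF g(1)] by blast
  \<comment> \<open>All orders are powers of \<open>p\<close>, so the maximal order is a multiple of
    every other one.\<close>
  have exp: "u [^] (p ^ j) = \<one>" if u: "u \<in> carrier G" for u
  proof -
    obtain k where k: "ord u = p ^ k" using ord_eq_power[OF u] by blast
    have "ord u \<le> ord g" using g(2) u finite_carrier by simp
    then have "k \<le> j" using j k p_gt_1 by simp
    then show ?thesis using pow_eq_id[OF u] k by (simp add: le_imp_power_dvd)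
  qed
  have "j \<noteq> 0" using exp[OF y(1)] y by (metis nat_pow_eone power_0)
  then obtain j' where j': "j = Suc j'" using not0_implies_Suc by blast
  let ?C = "generate G {g}"
  have sC: "subgroup ?C G" using g by (intro generate_is_subgroup) simp
  have C: "?C = {g [^] k | k. k \<in> (UNIV :: nat set)}"
    by (rule generate_pow_on_finite_carrier[OF finite_carrier g(1)])
  have gC: "g \<in> ?C" by (rule generate.incl) simp
  have "g \<noteq> \<one>" using j \<open>j \<noteq> 0\<close> ord_eq_1[OF g(1)] p_gt_1 by auto
  then have yC: "y \<in> ?C" using least[OF sC] gC by blast
  have "?C = carrier G"
  proof (rule ccontr)
    assume "?C \<noteq> carrier G"
    then obtain x where x: "x \<in> carrier G" "x \<notin> ?C" using subgroup.subset[OF sC] by blast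
    have ex: "x [^] (p ^ j) \<in> ?C" using exp[OF x(1)] subgroup.one_closed[OF sC] by simp
    \<comment> \<open>Minimality yields an element \<open>a\<close> outside \<open>?C\<close> whose
      \<open>p\<close>-th power is inside.\<close>
    define k where "k = (LEAST k. x [^] (p ^ k) \<in> ?C)"
    have k: "x [^] (p ^ k) \<in> ?C" unfolding k_def using ex by (rule LeastI)
    have "k \<noteq> 0" using k x by (metis nat_pow_eone power_0)
    then obtain k' where k': "k = Suc k'" using not0_implies_Suc by blast
    define a where "a = x [^] (p ^ k')"
    have ac: "a \<in> carrier G" unfolding a_def using x by simp
    have aC: "a \<notin> ?C"
    proof -
      have "k' < (LEAST k. x [^] (p ^ k) \<in> ?C)" using k' unfolding k_def by simp
      then show ?thesis unfolding a_def by (rule not_less_Least)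
    qed
    have "a [^] p \<in> ?C" unfolding a_def using k k' x by (simp add: nat_pow_pow mult.commute)
    then obtain i :: nat where i: "a [^] p = g [^] i" using C by blast
    \<comment> \<open>This is the power of \<open>a\<close> with exponent \<open>p ^ j\<close>.
      Since \<open>g\<close> has order \<open>p ^ j\<close>, it forces \<open>p\<close> to divide
      \<open>i\<close>.\<close>
    have "g [^] (i * p ^ j') = \<one>"
      using exp[OF ac] i j' ac g by (metis nat_pow_pow power_Suc)
    then have "p ^ j dvd i * p ^ j'" using pow_eq_id[OF g(1)] j by simp
    then have "p dvd i" using j' p_gt_1 by simp
    then obtain l where l: "i = p * l" by blast
    \<comment> \<open>\<open>g [^] l\<close> is a \<open>p\<close>-th root of \<open>a [^] p\<close>
      inside \<open>?C\<close>; dividing by it kills the \<open>p\<close>-th power but stays outside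
      \<open>?C\<close>.\<close>
    define b where "b = a \<otimes> inv (g [^] l)"
    have bc: "b \<in> carrier G" unfolding b_def using ac g by simp
    have "b [^] p = a [^] p \<otimes> inv (g [^] l) [^] p"
      unfolding b_def using ac g by (intro pow_mult_distrib comm) auto
    also have "inv (g [^] l) [^] p = inv (g [^] i)"
      using g l by (simp add: nat_pow_inv nat_pow_pow mult.commute)
    finally have bp: "b [^] p = \<one>" using i g by simp
    have bC: "b \<notin> ?C"
    proof
      assume "b \<in> ?C"
      moreover have "g [^] l \<in> ?C" using C by blast
      ultimately have "b \<otimes> g [^] l \<in> ?C" using subgroup.m_closed[OF sC] by blast
      then show False using aC ac g unfolding b_def by (simp add: m_assoc)
    qed
    let ?B = "generate G {b}"
    have sB: "subgroup ?B G" using bc by (intro generate_is_subgroup) simp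
    have bB: "b \<in> ?B" by (rule generate.incl) simp
    have "b \<noteq> \<one>" using bC subgroup.one_closed[OF sC] by auto
    then have "y \<in> ?B" using least[OF sB] bB by blast
    have "ord b dvd p" using bp pow_eq_id[OF bc] by simp
    then have cB: "card ?B \<le> p" using generate_pow_card[OF bc] p_gt_1 by (simp add: dvd_imp_le)
    have sI: "subgroup (?B \<inter> ?C) G" by (rule subgroups_Inter_pair[OF sB sC])
    have "?B \<inter> ?C \<subset> ?B" using bB bC by blast
    then have "p * card (?B \<inter> ?C) \<le> p"
      using card_subgroup_psubset[OF sI sB] cB by (meson le_trans)
    then have "card (?B \<inter> ?C) \<le> 1" using p_gt_1 by simp
    moreover have "{\<one>, y} \<subseteq> ?B \<inter> ?C"
      using \<open>y \<in> ?B\<close> yC subgroup.one_closed[OF sB] subgroup.one_closed[OF sC] by blast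
    ultimately have "card {\<one>, y} \<le> 1"
      using card_mono[OF finite_subgroup[OF sI]] le_trans by blast
    then show False using y by simp
  qed
  with that g show ?thesis by blast
qed

text \<open>
  Choose \<open>N\<close> maximal among the subgroups containing \<open>B\<close> but not \<open>y\<close>: then \<open>y\<close> lies in every nontrivial
  subgroup of the abelian group \<open>G/N\<close>.
\<close>
lemma cyclic_FactGroup_avoiding:
  assumes B: "subgroup B G" "derived G (carrier G) \<subseteq> B" and y: "y \<in> carrier G" "y \<notin> B"
  obtains N g j where "N \<lhd> G" "B \<subseteq> N" "y \<notin> N" "g \<in> carrier G"
    "\<And>i::nat. g [^] i \<in> N \<longleftrightarrow> p ^ j dvd i"
    "\<And>x. x \<in> carrier G \<Longrightarrow> \<exists>i::nat. \<exists>c\<in>N. x = g [^] i \<otimes> c"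
proof -
  let ?S = "{M. subgroup M G \<and> B \<subseteq> M \<and> y \<notin> M}"
  have "?S \<subseteq> Pow (carrier G)" using subgroup.subset by blast
  then have "finite ?S" using finite_carrier finite_subset by blast
  moreover have "B \<in> ?S" using B y by blast
  ultimately obtain N where N: "N \<in> ?S" "\<forall>M\<in>?S. N \<subseteq> M \<longrightarrow> N = M"
    using finite_has_maximal[of ?S] by blast
  then have DN: "derived G (carrier G) \<subseteq> N" using B by blast
  then have nN: "N \<lhd> G" using normal_if_derived_subset N by blast
  then interpret N: normal N G .
  obtain k where k: "p_group (G Mod N) p k" "p ^ k * card N = p ^ n"
    using p_group_FactGroup[OF nN] .
  then interpret Q: p_group "G Mod N" p k by simp
  have cen: "central_mod G N = carrier G"
    using central_mod_eq_carrier_iff[OF N.is_subgroup] DN by simp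
  obtain V where V: "V \<in> carrier (G Mod N)" "generate (G Mod N) {V} = carrier (G Mod N)"
  proof (rule Q.cyclic_if_least_nontrivial_subgroup)
    fix U V assume UV: "U \<in> carrier (G Mod N)" "V \<in> carrier (G Mod N)"
    then have "U \<in> center (G Mod N)"
      using cen N.central_mod_iff unfolding carrier_FactGroup by blast
    with UV show "U \<otimes>\<^bsub>G Mod N\<^esub> V = V \<otimes>\<^bsub>G Mod N\<^esub> U"
      unfolding center_def by blast
  next
    show "N #> y \<in> carrier (G Mod N)" using y by (auto simp: carrier_FactGroup)
    show "N #> y \<noteq> \<one>\<^bsub>G Mod N\<^esub>"
      using N(1) coset_join1[OF _ y(1) N.is_subgroup] by auto
  next
    fix A assume A: "subgroup A (G Mod N)" "A \<noteq> {\<one>\<^bsub>G Mod N\<^esub>}"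
    have U: "\<Union>A = {x \<in> carrier G. N #> x \<in> A}" by (rule N.factgroup_subgroup_union_char[OF A(1)])
    have sU: "subgroup (\<Union>A) G" by (rule N.factgroup_subgroup_union_subgroup[OF A(1)])
    have NU: "N \<subseteq> \<Union>A" by (rule N.subset_Union_subgroup_FactGroup[OF A(1)])
    have "N \<noteq> \<Union>A"
    proof
      assume eq: "N = \<Union>A"
      have "W = N" if "W \<in> A" for W
      proof -
        have "W \<in> carrier (G Mod N)"
          using subgroup.subset[OF A(1)] that by (rule subsetD)
        then obtain x where x: "x \<in> carrier G" "W = N #> x"
          by (auto simp: carrier_FactGroup)
        then have "x \<in> \<Union>A" using that unfolding U by simp
        then have "x \<in> N" using eq by simp
        then show ?thesis using x coset_join2[OF x(1) N.is_subgroup] by simp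
      qed
      moreover have "N \<in> A" using subgroup.one_closed[OF A(1)] by simp
      ultimately have "A = {N}" by blast
      then show False using A(2) by simp
    qed
    then have "y \<in> \<Union>A" using N sU NU by blast
    then show "N #> y \<in> A" using U by blast
  qed
  obtain g where g: "g \<in> carrier G" "V = N #> g" using V by (auto simp: carrier_FactGroup)
  obtain j where j: "Q.ord V = p ^ j" using Q.ord_eq_power[OF V(1)] by blast
  have "g [^] i \<in> N \<longleftrightarrow> p ^ j dvd i" for i :: nat
  proof -
    have "g [^] i \<in> N \<longleftrightarrow> V [^]\<^bsub>G Mod N\<^esub> i = \<one>\<^bsub>G Mod N\<^esub>"
      using g coset_join1[OF _ _ N.is_subgroup] coset_join2[OF _ N.is_subgroup]
      by (auto simp: N.FactGroup_pow)
    then show ?thesis using Q.pow_eq_id[OF V(1)] j by simp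
  qed
  moreover have "\<exists>i::nat. \<exists>c\<in>N. x = g [^] i \<otimes> c" if x: "x \<in> carrier G" for x
  proof -
    have "N #> x \<in> generate (G Mod N) {V}" using V x by (auto simp: carrier_FactGroup)
    then obtain i :: nat where "N #> x = V [^]\<^bsub>G Mod N\<^esub> i"
      unfolding Q.generate_pow_on_finite_carrier[OF Q.finite_carrier V(1)] by blast
    then have "N #> x = (N #> g) [^]\<^bsub>G Mod N\<^esub> i" using g(2) by simp
    then show ?thesis using N.coset_pow_mult[OF g(1) x] by blast
  qed
  ultimately show ?thesis using that[OF nN _ _ g(1)] N(1) by blast
qed

end

section \<open>Inner and central automorphisms\<close>

context group
begin

lemma inn_aut_apply: "x \<in> carrier G \<Longrightarrow> inn_aut G g x = g \<otimes> x \<otimes> inv g"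
  by (simp add: inn_aut_def)

lemma inn_aut_mem_auto:
  assumes g: "g \<in> carrier G" shows "inn_aut G g \<in> auto G"
proof -
  have "inn_aut G g \<in> hom G G"
  proof (rule homI)
    fix x y assume xy: "x \<in> carrier G" "y \<in> carrier G"
    have "inv g \<otimes> (g \<otimes> w) = w" if "w \<in> carrier G" for w
      using that g by (simp flip: m_assoc)
    then show "inn_aut G g (x \<otimes> y) = inn_aut G g x \<otimes> inn_aut G g y"
      using xy g by (simp add: inn_aut_apply m_assoc)
  qed (use g in \<open>simp add: inn_aut_apply\<close>)
  moreover have "bij_betw (inn_aut G g) (carrier G) (carrier G)"
  proof (rule bij_betw_byWitness[where f' = "inn_aut G (inv g)"])
    have "inv g \<otimes> (g \<otimes> w) = w" "g \<otimes> (inv g \<otimes> w) = w" if "w \<in> carrier G" for w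
      using that g by (simp_all flip: m_assoc)
    then show "\<forall>a\<in>carrier G. inn_aut G (inv g) (inn_aut G g a) = a"
      "\<forall>a\<in>carrier G. inn_aut G g (inn_aut G (inv g) a) = a"
      using g by (auto simp: inn_aut_apply m_assoc)
  qed (use g in \<open>auto simp: inn_aut_apply\<close>)
  ultimately show ?thesis
    by (simp add: auto_def Bij_def inn_aut_def)
qed

lemma inn_aut_hom: "inn_aut G \<in> hom G (AutoGroup G)"
proof (rule homI)
  fix g assume "g \<in> carrier G"
  then show "inn_aut G g \<in> carrier (AutoGroup G)"
    by (simp add: AutoGroup_def inn_aut_mem_auto)
next
  fix g h assume gh: "g \<in> carrier G" "h \<in> carrier G"
  have "inn_aut G (g \<otimes> h) = compose (carrier G) (inn_aut G g) (inn_aut G h)"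
    using gh by (auto simp: fun_eq_iff compose_def inn_aut_def inv_mult_group m_assoc)
  moreover have "inn_aut G g \<in> Bij (carrier G)" "inn_aut G h \<in> Bij (carrier G)"
    using gh inn_aut_mem_auto by (auto simp: auto_def)
  ultimately show "inn_aut G (g \<otimes> h) = inn_aut G g \<otimes>\<^bsub>AutoGroup G\<^esub> inn_aut G h"
    by (simp add: AutoGroup_def BijGroup_def)
qed

lemma inn_aut_eq_one_iff:
  assumes g: "g \<in> carrier G"
  shows "inn_aut G g = \<one>\<^bsub>AutoGroup G\<^esub> \<longleftrightarrow> g \<in> center G"
proof -
  have "g \<otimes> x \<otimes> inv g = x \<longleftrightarrow> g \<otimes> x = x \<otimes> g" if "x \<in> carrier G" for x
    using that g by (metis inv_solve_right' m_closed)
  moreover have "inn_aut G g = \<one>\<^bsub>AutoGroup G\<^esub> \<longleftrightarrow> (\<forall>x\<in>carrier G. g \<otimes> x \<otimes> inv g = x)"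
    by (auto simp: AutoGroup_def BijGroup_def inn_aut_def fun_eq_iff)
  ultimately show ?thesis using g by (simp add: center_def)
qed

lemma group_hom_inn_aut: "group_hom G (AutoGroup G) (inn_aut G)"
  using inn_aut_hom AutoGroup by (simp add: group_hom_def group_hom_axioms_def is_group)

text \<open>The kernel of \<open>inn_aut G\<close> is the centre, so two inner automorphisms commute
  exactly when the commutator of their elements is central.\<close>

lemma center_InnGroup: "center (InnGroup G) = inn_aut G ` central_mod G (center G)"
proof -
  interpret i: group_hom G "AutoGroup G" "inn_aut G" by (rule group_hom_inn_aut)
  have "inn_aut G g \<otimes>\<^bsub>AutoGroup G\<^esub> inn_aut G x = inn_aut G x \<otimes>\<^bsub>AutoGroup G\<^esub> inn_aut G g
      \<longleftrightarrow> x \<otimes> g \<otimes> inv x \<otimes> inv g \<in> center G"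
    if gx: "g \<in> carrier G" "x \<in> carrier G" for g x
  proof -
    have "inn_aut G (x \<otimes> g \<otimes> inv x \<otimes> inv g) = inn_aut G x \<otimes>\<^bsub>AutoGroup G\<^esub> inn_aut G g
        \<otimes>\<^bsub>AutoGroup G\<^esub> inv\<^bsub>AutoGroup G\<^esub> inn_aut G x \<otimes>\<^bsub>AutoGroup G\<^esub> inv\<^bsub>AutoGroup G\<^esub> inn_aut G g"
      using gx by simp
    then show ?thesis
      using inn_aut_eq_one_iff[of "x \<otimes> g \<otimes> inv x \<otimes> inv g"] gx
        i.H.commutator_eq_one_iff[of "inn_aut G x" "inn_aut G g"] by auto
  qed
  \<comment> \<open>\<open>center_def\<close> is instantiated so that only the centre of the
    automorphism group is unfolded and \<open>center G\<close> stays folded.\<close>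
  then have "inn_aut G g \<in> center (InnGroup G) \<longleftrightarrow> g \<in> central_mod G (center G)"
    if "g \<in> carrier G" for g
    using that by (simp add: center_def[of "AutoGroup G\<lparr>carrier := inn_aut G ` carrier G\<rparr>"]
      InnGroup_def Inn_def central_mod_def)
  moreover have "center (InnGroup G) \<subseteq> inn_aut G ` carrier G"
    by (auto simp: center_def InnGroup_def Inn_def)
  moreover have "central_mod G (center G) \<subseteq> carrier G"
    by (auto simp: central_mod_def)
  ultimately show ?thesis by blast
qed

lemma card_center_InnGroup: "card (center (InnGroup G)) * card (center G) = card (central_mod G (center G))"
proof -
  let ?Z2 = "central_mod G (center G)"
  interpret Z: normal "center G" G by (rule normal_center)
  interpret Z2: normal ?Z2 G by (rule Z.normal_central_mod)
  interpret i: group_hom "G\<lparr>carrier := ?Z2\<rparr>" "AutoGroup G" "inn_aut G"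
    using inn_aut_hom AutoGroup Z2.subgroup_is_group[OF is_group] Z2.subset
    by (fastforce simp: group_hom_def group_hom_axioms_def hom_def)
  have "kernel (G\<lparr>carrier := ?Z2\<rparr>) (AutoGroup G) (inn_aut G) = center G"
    using inn_aut_eq_one_iff Z2.subset Z.subset_central_mod by (auto simp: kernel_def)
  then show ?thesis
    using i.card_image_mult_card_kernel by (simp add: center_InnGroup order_def)
qed

text \<open>The value at \<open>x\<close> is central, so it can be moved past
  \<open>inv y\<close>.\<close>

lemma Aut_c_hom:
  assumes a: "\<alpha> \<in> Aut_c G"
  shows "(\<lambda>x. inv x \<otimes> \<alpha> x) \<in> hom G G"
proof (rule homI)
  have \<alpha>: "\<alpha> \<in> hom G G" using a by (simp add: Aut_c_def auto_def)
  note c = hom_in_carrier[OF \<alpha>]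
  show "inv x \<otimes> \<alpha> x \<in> carrier G" if "x \<in> carrier G" for x using that c by simp
  fix x y assume xy: "x \<in> carrier G" "y \<in> carrier G"
  have "inv x \<otimes> \<alpha> x \<in> center G" using a xy by (simp add: Aut_c_def)
  then have "inv x \<otimes> \<alpha> x \<otimes> inv y = inv y \<otimes> (inv x \<otimes> \<alpha> x)"
    using xy by (simp add: center_commute)
  then have "inv x \<otimes> \<alpha> x \<otimes> (inv y \<otimes> \<alpha> y) = inv y \<otimes> (inv x \<otimes> \<alpha> x) \<otimes> \<alpha> y"
    using xy c by (simp flip: m_assoc)
  then show "inv (x \<otimes> y) \<otimes> \<alpha> (x \<otimes> y) = inv x \<otimes> \<alpha> x \<otimes> (inv y \<otimes> \<alpha> y)"
    using xy c hom_mult[OF \<alpha>] by (simp add: inv_mult_group m_assoc)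
qed

text \<open>A converse to the preceding lemma. If \<open>x \<otimes> h x = \<one>\<close>, then
  \<open>x\<close> is the inverse of a central element, so injectivity is a question about the
  centre alone. Surjectivity follows by finiteness.\<close>

lemma mem_Aut_cI:
  assumes fin: "finite (carrier G)" and h: "h \<in> hom G G" "h ` carrier G \<subseteq> center G"
    and inj: "\<And>x. x \<in> center G \<Longrightarrow> x \<otimes> h x = \<one> \<Longrightarrow> x = \<one>"
  shows "(\<lambda>x\<in>carrier G. x \<otimes> h x) \<in> Aut_c G"
proof -
  let ?\<alpha> = "\<lambda>x\<in>carrier G. x \<otimes> h x"
  note c = hom_in_carrier[OF h(1)]
  have hz: "h x \<in> center G" if "x \<in> carrier G" for x using that h(2) by blast
  have \<alpha>: "?\<alpha> \<in> hom G G"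
  proof (rule homI)
    fix x y assume xy: "x \<in> carrier G" "y \<in> carrier G"
    have "h x \<otimes> (y \<otimes> h y) = y \<otimes> (h x \<otimes> h y)"
      using center_commute[OF hz[OF xy(1)] xy(2)] xy c by (simp flip: m_assoc)
    then show "?\<alpha> (x \<otimes> y) = ?\<alpha> x \<otimes> ?\<alpha> y"
      using xy c hom_mult[OF h(1)] by (simp add: m_assoc)
  qed (use c in simp)
  then interpret \<alpha>: group_hom G G ?\<alpha>
    by (simp add: group_hom_def group_hom_axioms_def is_group)
  have "inj_on ?\<alpha> (carrier G)"
  proof (rule \<alpha>.inj_on_one_iff[THEN iffD2], intro ballI impI allI)
    fix x assume x: "x \<in> carrier G" "?\<alpha> x = \<one>"
    then have "x \<otimes> h x = \<one>" by simp
    then have "x = inv (h x)" using x c by (simp add: inv_equality)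
    then have "x \<in> center G"
      using subgroup.m_inv_closed[OF subgroup_center hz[OF x(1)]] by simp
    then show "x = \<one>" using inj x by simp
  qed
  moreover have "?\<alpha> ` carrier G \<subseteq> carrier G" using c by auto
  ultimately have "bij_betw ?\<alpha> (carrier G) (carrier G)"
    using endo_inj_surj[OF fin] unfolding bij_betw_def by blast
  then have "?\<alpha> \<in> auto G" using \<alpha> by (simp add: auto_def Bij_def)
  moreover have "inv x \<otimes> (x \<otimes> h x) = h x" if "x \<in> carrier G" for x
    using that c by (simp flip: m_assoc)
  ultimately show ?thesis using hz by (simp add: Aut_c_def)
qed

lemma center_InnGroup_subset_Aut_cZ: "center (InnGroup G) \<subseteq> Aut_cZ G"
proof
  fix \<alpha> assume "\<alpha> \<in> center (InnGroup G)"
  then obtain g where g: "g \<in> central_mod G (center G)" and \<alpha>: "\<alpha> = inn_aut G g"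
    by (auto simp: center_InnGroup)
  then have gc: "g \<in> carrier G" by (simp add: central_mod_def)
  have "inv x \<otimes> \<alpha> x \<in> center G" if x: "x \<in> carrier G" for x
  proof -
    \<comment> \<open>For conjugation by \<open>g\<close>, the element
      \<open>inv x \<otimes> \<alpha> x\<close> is the commutator of \<open>inv x\<close> and
      \<open>g\<close>.\<close>
    have "inv x \<otimes> g \<otimes> inv (inv x) \<otimes> inv g \<in> center G"
      using g inv_closed[OF x] unfolding central_mod_def by blast
    then show ?thesis using x gc by (simp add: \<alpha> inn_aut_apply m_assoc)
  qed
  moreover have "\<alpha> z = z" if "z \<in> center G" for z
  proof -
    have "z \<in> carrier G" using that by (simp add: center_def)
    then show ?thesis
      using center_commute[OF that gc, symmetric] gc by (simp add: \<alpha> inn_aut_apply) (simp add: m_assoc)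
  qed
  ultimately show "\<alpha> \<in> Aut_cZ G"
    using inn_aut_mem_auto[OF gc] by (auto simp: Aut_cZ_def Aut_c_def \<alpha>)
qed

text \<open>The form in which the equality is exploited: \<open>x \<otimes> h x\<close> defines a
  central automorphism fixing \<open>Z\<close>, so it is conjugation by an element of
  \<open>Z2\<close>, and solving for \<open>h x\<close> gives a commutator.\<close>

lemma hom_inner_if_center_InnGroup_eq:
  assumes fin: "finite (carrier G)" and eq: "center (InnGroup G) = Aut_cZ G"
    and h: "h \<in> hom G G" "h ` carrier G \<subseteq> center G" and hZ: "\<And>z. z \<in> center G \<Longrightarrow> h z = \<one>"
  obtains g where "g \<in> central_mod G (center G)"
    "\<And>x. x \<in> carrier G \<Longrightarrow> h x = inv x \<otimes> g \<otimes> x \<otimes> inv g"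
proof -
  let ?\<alpha> = "\<lambda>x\<in>carrier G. x \<otimes> h x"
  have Z: "z \<in> carrier G" if "z \<in> center G" for z using that by (simp add: center_def)
  have "?\<alpha> \<in> Aut_c G"
    using mem_Aut_cI[OF fin h] hZ Z by simp
  then have "?\<alpha> \<in> center (InnGroup G)"
    unfolding eq using hZ Z by (simp add: Aut_cZ_def)
  then obtain g where g: "g \<in> central_mod G (center G)" "?\<alpha> = inn_aut G g"
    by (auto simp: center_InnGroup)
  have gc: "g \<in> carrier G" using g by (simp add: central_mod_def)
  have "h x = inv x \<otimes> g \<otimes> x \<otimes> inv g" if x: "x \<in> carrier G" for x
  proof -
    have "x \<otimes> h x = g \<otimes> x \<otimes> inv g"
      using fun_cong[OF g(2), of x] x by (simp add: inn_aut_apply)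
    then have "inv x \<otimes> (x \<otimes> h x) = inv x \<otimes> (g \<otimes> x \<otimes> inv g)" by simp
    then show ?thesis
      using x gc hom_in_carrier[OF h(1) x] by (simp flip: m_assoc)
  qed
  with g that show ?thesis by blast
qed

section \<open>Cyclic subgroups and \<open>integer_mod_group\<close>\<close>

lemma subgroup_iso_integer_mod_group:
  assumes H: "subgroup H G" "finite H" and c: "c \<in> H" "ord c = card H"
  shows "G\<lparr>carrier := H\<rparr> \<cong> integer_mod_group (card H)"
proof -
  let ?m = "card H"
  have cc: "c \<in> carrier G" using c H subgroup.mem_carrier by metis
  have m: "0 < ?m" using c H by (auto simp: card_gt_0_iff)
  interpret H: group "G\<lparr>carrier := H\<rparr>" using H subgroup_imp_group by blast
  \<comment> \<open>Addition in \<open>integer_mod_group\<close> reduces modulo \<open>?m\<close>,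
    which powers of \<open>c\<close> do not notice.\<close>
  have pow: "c [^] (x mod int ?m) = c [^] x" for x :: int
    using int_pow_eq[OF cc, of "x mod int ?m" x] c(2) by (simp add: mod_eq_dvd_iff[symmetric])
  have mem: "c [^] x \<in> H" for x :: int
    using subgroup_int_pow_closed[OF H(1) c(1)] .
  have "(\<lambda>x::int. c [^] x) \<in> iso (integer_mod_group ?m) (G\<lparr>carrier := H\<rparr>)"
  proof (rule isoI)
    show "(\<lambda>x::int. c [^] x) \<in> hom (integer_mod_group ?m) (G\<lparr>carrier := H\<rparr>)"
      using mem cc by (auto simp: hom_def pow int_pow_mult)
    have inj: "inj_on (\<lambda>x::int. c [^] x) (carrier (integer_mod_group ?m))"
    proof (rule inj_onI)
      fix x y :: int assume xy: "x \<in> carrier (integer_mod_group ?m)" "y \<in> carrier (integer_mod_group ?m)"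
        "c [^] x = c [^] y"
      then have "int ?m dvd y - x" using int_pow_eq[OF cc, of x y] c(2) by simp
      then have "y mod int ?m = x mod int ?m" by (simp add: mod_eq_dvd_iff)
      then show "x = y" using xy m by (simp add: carrier_integer_mod_group)
    qed
    have "(\<lambda>x::int. c [^] x) ` carrier (integer_mod_group ?m) \<subseteq> H" using mem by auto
    moreover have "card ((\<lambda>x::int. c [^] x) ` carrier (integer_mod_group ?m)) = card H"
      using card_image[OF inj] m by (simp add: carrier_integer_mod_group)
    ultimately have "(\<lambda>x::int. c [^] x) ` carrier (integer_mod_group ?m) = H"
      using card_subset_eq[OF H(2)] by blast
    with inj show "bij_betw (\<lambda>x::int. c [^] x) (carrier (integer_mod_group ?m)) (carrier (G\<lparr>carrier := H\<rparr>))"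
      by (simp add: bij_betw_def)
  qed
  then show ?thesis
    using group.iso_sym[OF group_integer_mod_group] is_isoI by blast
qed

lemma generator_if_iso_integer_mod_group:
  assumes H: "subgroup H G" and iso: "G\<lparr>carrier := H\<rparr> \<cong> integer_mod_group m" and m: "1 < m"
  obtains c where "c \<in> H" "ord c = m"
proof -
  interpret H: group "G\<lparr>carrier := H\<rparr>" using H subgroup_imp_group by blast
  obtain f where f: "f \<in> iso (integer_mod_group m) (G\<lparr>carrier := H\<rparr>)"
    using H.iso_sym[OF iso] unfolding is_iso_def by blast
  then interpret f: group_hom "integer_mod_group m" "G\<lparr>carrier := H\<rparr>" f
    by (simp add: group_hom_def group_hom_axioms_def iso_def)
  have one: "(1::int) \<in> carrier (integer_mod_group m)" using m by simp
  have c: "f 1 \<in> H" using f.hom_closed[OF one] by simp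
  then have cc: "f 1 \<in> carrier G" using H subgroup.mem_carrier by metis
  \<comment> \<open>The image of the generator 1 is the candidate; its order is found through
    divisibility of the exponents that kill it.\<close>
  have "f 1 [^] k = \<one> \<longleftrightarrow> m dvd k" for k :: nat
  proof -
    have "f 1 [^] k = f (int k mod int m)"
      using f.hom_nat_pow[OF one, of k] m nat_pow_consistent[of "f 1" k H] by simp
    moreover have "f (int k mod int m) = \<one> \<longleftrightarrow> int k mod int m = 0"
    proof -
      have "inj_on f (carrier (integer_mod_group m))"
        using f by (simp add: iso_def bij_betw_def)
      moreover have "int k mod int m \<in> carrier (integer_mod_group m)"
        using m by (simp add: carrier_integer_mod_group)
      ultimately show ?thesis
        using f.hom_one by (auto dest: inj_onD[where y = 0])
    qed
    ultimately show ?thesis by (simp flip: zmod_int dvd_eq_mod_eq_0)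
  qed
  then have "ord (f 1) = m"
    using pow_eq_id[OF cc] by (metis dvd_antisym dvd_refl)
  with c that show ?thesis by blast
qed

end

section \<open>Products with a normal subgroup\<close>

context normal
begin

text \<open>The product formula: the image of \<open>K\<close> in \<open>G/H\<close> has preimage
  \<open>K <#> H\<close>, and the projection restricted to \<open>K\<close> has kernel
  \<open>K \<inter> H\<close>.\<close>

lemma card_set_mult:
  assumes "subgroup K G"
  shows "card (K <#> H) * card (K \<inter> H) = card K * card H"
proof -
  interpret K: subgroup K G by fact
  interpret Q: group "G Mod H" by (rule factorgroup_is_group)
  interpret h: group_hom "G\<lparr>carrier := K\<rparr>" "G Mod H" "\<lambda>x. H #> x"
    using r_coset_hom_Mod K.subset K.subgroup_is_group[OF is_group]
    by (fastforce simp: group_hom_def group_hom_axioms_def factorgroup_is_group hom_def)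
  let ?A = "(\<lambda>x. H #> x) ` K"
  have A: "subgroup ?A (G Mod H)" using h.img_is_subgroup by simp
  have "kernel (G\<lparr>carrier := K\<rparr>) (G Mod H) (\<lambda>x. H #> x) = K \<inter> H"
    using coset_join1[OF _ _ is_subgroup] coset_join2[OF _ is_subgroup] K.subset
    by (auto simp: kernel_def)
  then have "card ?A * card (K \<inter> H) = card K"
    using h.card_image_mult_card_kernel by (simp add: order_def)
  moreover have "\<Union>?A = K <#> H"
  proof -
    have "\<Union>?A = (\<Union>x\<in>K. x <# H)" using coset_eq K.subset by blast
    then show ?thesis by (auto simp: set_mult_def l_coset_def)
  qed
  ultimately show ?thesis
    using card_Union_subgroup_FactGroup[OF A] by (simp add: ac_simps)
qed

lemma subgroup_set_mult: "subgroup K G \<Longrightarrow> subgroup (K <#> H) G"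
  using mult_norm_subgroup[OF normal_axioms] commut_normal[OF _ normal_axioms] by simp

lemma set_mult_memI: "k \<in> K \<Longrightarrow> h \<in> H \<Longrightarrow> k \<otimes> h \<in> K <#> H"
  by (auto simp: set_mult_def)

lemma subset_set_mult:
  assumes "subgroup K G" shows "K \<subseteq> K <#> H" "H \<subseteq> K <#> H"
proof -
  interpret K: subgroup K G by fact
  show "K \<subseteq> K <#> H"
  proof
    fix k assume "k \<in> K"
    then have "k \<otimes> \<one> \<in> K <#> H" by (intro set_mult_memI subgroup.one_closed[OF is_subgroup])
    then show "k \<in> K <#> H" using \<open>k \<in> K\<close> by simp
  qed
  show "H \<subseteq> K <#> H"
  proof
    fix h assume "h \<in> H"
    then have "\<one> \<otimes> h \<in> K <#> H" by (intro set_mult_memI K.one_closed)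
    then show "h \<in> K <#> H" using \<open>h \<in> H\<close> by simp
  qed
qed

lemma set_mult_subset:
  assumes "subgroup L G" "K \<subseteq> L" "H \<subseteq> L" shows "K <#> H \<subseteq> L"
  using assms subgroup.m_closed[OF assms(1)] by (auto simp: set_mult_def)

end

context p_group
begin

text \<open>\<open>H\<close> is cyclic with generator \<open>c\<close>, so its elements killed by
  \<open>p\<close> form the group generated by \<open>c [^] p\<close>, of order
  \<open>p\<close>.\<close>

lemma card_p_torsion:
  assumes H: "subgroup H G" "card H = p\<^sup>2" and c: "c \<in> H" "ord c = p\<^sup>2"
  shows "card {x \<in> H. x [^] p = \<one>} = p"
proof -
  have cc: "c \<in> carrier G" using c H subgroup.mem_carrier by metis
  have "generate G {c} \<subseteq> H" using generate_subgroup_incl[OF _ H(1)] c by simp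
  moreover have "card (generate G {c}) = card H" using generate_pow_card[OF cc] H c by simp
  ultimately have "generate G {c} = H" using card_subset_eq finite_subgroup[OF H(1)] by blast
  then have Hc: "H = {c [^] k | k. k \<in> (UNIV :: nat set)}"
    using generate_pow_on_finite_carrier[OF finite_carrier cc] by simp
  have pow: "(c [^] k) [^] p = \<one> \<longleftrightarrow> p dvd k" for k :: nat
    using pow_eq_id[OF cc, of "k * p"] c cc p_gt_1 by (simp add: nat_pow_pow power2_eq_square)
  have "{x \<in> H. x [^] p = \<one>} = {c [^] k | k. k \<in> (UNIV :: nat set) \<and> p dvd k}"
    unfolding Hc using pow by auto
  also have "\<dots> = {(c [^] p) [^] k | k. k \<in> (UNIV :: nat set)}"
    using cc by (auto simp: nat_pow_pow elim!: dvdE)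
  also have "\<dots> = generate G {c [^] p}"
    using generate_pow_on_finite_carrier[OF finite_carrier, of "c [^] p"] cc by simp
  finally have "card {x \<in> H. x [^] p = \<one>} = ord (c [^] p)"
    using generate_pow_card[of "c [^] p"] cc by simp
  also have "ord (c [^] p) = p"
    using ord_pow_gen[OF cc, of p] c(2) p_gt_1 by (simp add: power2_eq_square)
  finally show ?thesis .
qed

end

section \<open>Groups with \<open>Z(Inn G) = Aut_cZ G\<close>\<close>

text \<open>Modulo \<open>H\<close> the factor \<open>c\<close> disappears, so only the power of
  \<open>g\<close> matters.\<close>

lemma (in normal) power_mult_mem_iff:
  fixes i m :: nat
  assumes g: "g \<in> carrier G" and c: "c \<in> H"
  shows "(g [^] i \<otimes> c) [^] m \<in> H \<longleftrightarrow> g [^] (i * m) \<in> H"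
proof -
  have cc: "c \<in> carrier G" using c by simp
  have gi: "g [^] i \<in> carrier G" using g by simp
  have "H #> (g [^] i \<otimes> c) = H #> (g [^] i)"
    using coset_eq_iff[OF is_subgroup, of "g [^] i \<otimes> c" "g [^] i"] gi cc inv_op_closed2[OF gi c] by simp
  then have "H #> ((g [^] i \<otimes> c) [^] m) = H #> (g [^] (i * m))"
    using FactGroup_pow[of "g [^] i \<otimes> c" m] FactGroup_pow[OF gi, of m] g gi cc
    by (simp add: nat_pow_pow)
  then show ?thesis
    using coset_join1[OF _ _ is_subgroup] coset_join2[OF _ is_subgroup] g cc by (metis m_closed nat_pow_closed)
qed

context p_group
begin

text \<open>Here \<open>p ^ j\<close> is the order of a cyclic quotient \<open>G/N\<close> with
  \<open>B\<close> inside \<open>N\<close> and \<open>y\<close> outside. It is bounded below if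
  \<open>y\<close> is a \<open>p\<close>-power and above by the exponent of \<open>G/B\<close>. The
  generator of \<open>G/N\<close> may be sent to any \<open>z\<close> killed by
  \<open>p ^ j\<close>; if \<open>z\<close> has order exactly \<open>p ^ j\<close>, the kernel is
  \<open>N\<close>, which misses \<open>y\<close>.\<close>

lemma separating_hom:
  assumes B: "subgroup B G" "derived G (carrier G) \<subseteq> B" and y: "y \<in> carrier G" "y \<notin> B"
  obtains j where
    "\<And>x t. x \<in> carrier G \<Longrightarrow> y = x [^] (p ^ t) \<Longrightarrow> t < j"
    "\<And>t. (\<And>x. x \<in> carrier G \<Longrightarrow> x [^] (p ^ t) \<in> B) \<Longrightarrow> j \<le> t"
    "\<And>z. z \<in> carrier G \<Longrightarrow> z [^] (p ^ j) = \<one> \<Longrightarrow>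
      \<exists>h \<in> hom G G. (\<forall>b\<in>B. h b = \<one>) \<and> z \<in> h ` carrier G \<and>
        (\<forall>x\<in>carrier G. \<exists>i::nat. h x = z [^] i) \<and> (ord z = p ^ j \<longrightarrow> h y \<noteq> \<one>)"
proof -
  obtain N g j where N: "N \<lhd> G" "B \<subseteq> N" "y \<notin> N" and g: "g \<in> carrier G"
    and g_pow: "\<And>i::nat. g [^] i \<in> N \<longleftrightarrow> p ^ j dvd i"
    and gen: "\<And>x. x \<in> carrier G \<Longrightarrow> \<exists>i::nat. \<exists>c\<in>N. x = g [^] i \<otimes> c"
    using cyclic_FactGroup_avoiding[OF B y] by blast
  interpret N: normal N G by fact
  show ?thesis
  proof (rule that[of j])
    fix x and t :: nat assume x: "x \<in> carrier G" "y = x [^] (p ^ t)"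
    obtain i :: nat and c where c: "c \<in> N" "x = g [^] i \<otimes> c" using gen[OF x(1)] by blast
    have "\<not> p ^ j dvd i * p ^ t"
      using N.power_mult_mem_iff[OF g c(1), of i "p ^ t"] g_pow N(3) c(2) x(2) by simp
    then have "\<not> j \<le> t" using le_imp_power_dvd[of j t p] by (metis dvd_mult)
    then show "t < j" by simp
  next
    fix t assume t: "\<And>x. x \<in> carrier G \<Longrightarrow> x [^] (p ^ t) \<in> B"
    then have "p ^ j dvd p ^ t" using g_pow g N by blast
    then show "j \<le> t" using p_gt_1 power_dvd_imp_le by blast
  next
    fix z assume z: "z \<in> carrier G" "z [^] (p ^ j) = \<one>"
    obtain h where h: "h \<in> hom G G" "\<And>i::nat. \<And>c. c \<in> N \<Longrightarrow> h (g [^] i \<otimes> c) = z [^] i"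
      using hom_from_cyclic_FactGroup[OF N(1) g _ gen z] g_pow by blast
    have "h b = \<one>" if "b \<in> B" for b
      using h(2)[of b 0] that N(2) N.mem_carrier by (simp add: subset_iff)
    moreover have "z \<in> h ` carrier G"
      using h(2)[OF N.one_closed, of 1] g z by (intro image_eqI[of _ _ g]) simp_all
    moreover have "\<exists>i::nat. h x = z [^] i" if "x \<in> carrier G" for x
      using gen[OF that] h(2) by blast
    moreover have "h y \<noteq> \<one>" if "ord z = p ^ j"
    proof -
      obtain i :: nat and c where c: "c \<in> N" "y = g [^] i \<otimes> c" using gen[OF y(1)] by blast
      have "\<not> p ^ j dvd i"
        using N.power_mult_mem_iff[OF g c(1), of i 1] g_pow N(3) c y(1) by simp
      then show ?thesis using h(2)[OF c(1)] c(2) pow_eq_id[OF z(1)] that by simp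
    qed
    ultimately show "\<exists>h \<in> hom G G. (\<forall>b\<in>B. h b = \<one>) \<and> z \<in> h ` carrier G \<and>
        (\<forall>x\<in>carrier G. \<exists>i::nat. h x = z [^] i) \<and> (ord z = p ^ j \<longrightarrow> h y \<noteq> \<one>)"
      using h(1) by blast
  qed
qed

text \<open>Otherwise \<open>separating_hom\<close> applies with \<open>j > t\<close>, so the order
  of \<open>c\<close> divides \<open>p ^ j\<close> and some homomorphism trivial on
  \<open>G'Z\<close> takes the value \<open>c\<close>. By the assumed equality its values are
  commutators, against \<open>c\<close> being outside \<open>G'\<close>.\<close>

lemma power_mem_derived_center:
  assumes eq: "center (InnGroup G) = Aut_cZ G"
    and c: "c \<in> center G" "c \<notin> derived G (carrier G)" "ord c = p ^ Suc t"
    and x: "x \<in> carrier G"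
  shows "x [^] (p ^ t) \<in> derived G (carrier G) <#> center G"
proof (rule ccontr)
  let ?D = "derived G (carrier G) <#> center G"
  assume not: "x [^] (p ^ t) \<notin> ?D"
  interpret Z: normal "center G" G by (rule normal_center)
  have sG': "subgroup (derived G (carrier G)) G" by (simp add: derived_is_subgroup)
  have D: "subgroup ?D G" "derived G (carrier G) \<subseteq> ?D" "center G \<subseteq> ?D"
    using Z.subgroup_set_mult[OF sG'] Z.subset_set_mult[OF sG'] by blast+
  obtain j where j: "t < j"
    and h: "\<And>z. z \<in> carrier G \<Longrightarrow> z [^] (p ^ j) = \<one> \<Longrightarrow>
      \<exists>h \<in> hom G G. (\<forall>b\<in>?D. h b = \<one>) \<and> z \<in> h ` carrier G \<and> (\<forall>x\<in>carrier G. \<exists>i::nat. h x = z [^] i)"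
    using separating_hom[OF D(1,2) nat_pow_closed[OF x] not] x by metis
  have cc: "c \<in> carrier G" using c by auto
  have "c [^] (p ^ j) = \<one>"
    using pow_eq_id[OF cc] c(3) j le_imp_power_dvd[of "Suc t" j p] by simp
  then obtain h where h: "h \<in> hom G G" "\<forall>b\<in>?D. h b = \<one>" "c \<in> h ` carrier G"
    "\<forall>x\<in>carrier G. \<exists>i::nat. h x = c [^] i"
    using h[OF cc] by blast
  have hZ: "h ` carrier G \<subseteq> center G" using h(4) pow_mem_center[OF c(1)] by fastforce
  obtain g where g: "g \<in> central_mod G (center G)"
      "\<And>x. x \<in> carrier G \<Longrightarrow> h x = inv x \<otimes> g \<otimes> x \<otimes> inv g"
    using hom_inner_if_center_InnGroup_eq[OF finite_carrier eq h(1) hZ] h(2) D(3) by blast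
  obtain u where u: "u \<in> carrier G" "c = h u" using h(3) by blast
  have "g \<in> carrier G" using g(1) by (simp add: central_mod_def)
  then have "c \<in> derived G (carrier G)"
    using commutator_mem_derived[of "inv u" g] u g(2) by simp
  then show False using c by simp
qed

text \<open>The exponent of \<open>G/B\<close> divides \<open>p ^ t\<close>, so the powers of
  \<open>c\<close> include an element of the order needed for a homomorphism into \<open>Z\<close>
  that is trivial on \<open>B\<close> but not at \<open>y\<close>. The assumed equality realizes it
  as a commutator map with some \<open>g\<close> in \<open>Z2\<close>.\<close>

lemma second_center_separates:
  assumes eq: "center (InnGroup G) = Aut_cZ G"
    and c: "c \<in> center G" "c \<notin> derived G (carrier G)" "ord c = p ^ Suc t"
    and B: "subgroup B G" "derived G (carrier G) <#> center G \<subseteq> B"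
    and y: "y \<in> carrier G" "y \<notin> B"
  obtains g where "g \<in> central_mod G (center G)" "\<And>b. b \<in> B \<Longrightarrow> g \<otimes> b = b \<otimes> g" "g \<otimes> y \<noteq> y \<otimes> g"
proof -
  let ?D = "derived G (carrier G) <#> center G"
  interpret Z: normal "center G" G by (rule normal_center)
  have sG': "subgroup (derived G (carrier G)) G" by (simp add: derived_is_subgroup)
  have D: "derived G (carrier G) \<subseteq> B" "center G \<subseteq> B"
    using Z.subset_set_mult[OF sG'] B by blast+
  have cc: "c \<in> carrier G" using c by auto
  show ?thesis
  proof (rule separating_hom[OF B(1) D(1) y])
    fix j
    assume j: "\<And>t. (\<And>x. x \<in> carrier G \<Longrightarrow> x [^] (p ^ t) \<in> B) \<Longrightarrow> j \<le> t"
      and sep: "\<And>z. z \<in> carrier G \<Longrightarrow> z [^] (p ^ j) = \<one> \<Longrightarrow>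
        \<exists>h \<in> hom G G. (\<forall>b\<in>B. h b = \<one>) \<and> z \<in> h ` carrier G \<and>
          (\<forall>x\<in>carrier G. \<exists>i::nat. h x = z [^] i) \<and> (ord z = p ^ j \<longrightarrow> h y \<noteq> \<one>)"
    have "x [^] (p ^ t) \<in> B" if "x \<in> carrier G" for x
      using power_mem_derived_center[OF eq c that] B(2) by blast
    then have jt: "j \<le> t" by (rule j)
    \<comment> \<open>The exponent lowers the order from \<open>p ^ Suc t\<close> to exactly
      \<open>p ^ j\<close>.\<close>
    define z where "z = c [^] (p ^ (Suc t - j))"
    have z: "z \<in> center G" "z \<in> carrier G"
      using pow_mem_center[OF c(1)] Z.subset unfolding z_def by blast+
    have "p ^ Suc t = p ^ (Suc t - j) * p ^ j" using jt by (simp flip: power_add)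
    then have oz: "ord z = p ^ j"
      using ord_pow[OF cc, of "p ^ (Suc t - j)"] c(3) p_gt_1 unfolding z_def by simp
    then have "z [^] (p ^ j) = \<one>" using pow_eq_id[OF z(2)] by simp
    then obtain h where h: "h \<in> hom G G" "\<forall>b\<in>B. h b = \<one>"
      "\<forall>x\<in>carrier G. \<exists>i::nat. h x = z [^] i" "h y \<noteq> \<one>"
      using sep[OF z(2)] oz by blast
    have hZ: "h ` carrier G \<subseteq> center G" using h(3) pow_mem_center[OF z(1)] by fastforce
    obtain g where g: "g \<in> central_mod G (center G)"
        "\<And>x. x \<in> carrier G \<Longrightarrow> h x = inv x \<otimes> g \<otimes> x \<otimes> inv g"
      using hom_inner_if_center_InnGroup_eq[OF finite_carrier eq h(1) hZ] h(2) D(2) by blast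
    have gc: "g \<in> carrier G" using g(1) by (simp add: central_mod_def)
    have iff: "h x = \<one> \<longleftrightarrow> g \<otimes> x = x \<otimes> g" if x: "x \<in> carrier G" for x
    proof -
      have "h x = \<one> \<longleftrightarrow> inv x \<otimes> g = g \<otimes> inv x"
        using commutator_eq_one_iff[of "inv x" g] g(2)[OF x] x gc by simp
      also have "\<dots> \<longleftrightarrow> g = x \<otimes> (g \<otimes> inv x)"
        using x gc by (metis inv_solve_left m_closed inv_closed)
      also have "\<dots> \<longleftrightarrow> g \<otimes> x = x \<otimes> g"
        using x gc by (metis inv_solve_right m_assoc m_closed inv_closed)
      finally show ?thesis .
    qed
    show ?thesis
      using that[OF g(1)] iff h(2,4) y(1) subgroup.mem_carrier[OF B(1)] by blast
  qed
qed

text \<open>This is the estimate of \<open>|G : D|\<close> by \<open>|Z2 : Z|\<close>, cleared of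
  quotients. Let \<open>C B\<close> be the centralizer of \<open>B\<close> in \<open>Z2\<close>.
  Enlarging \<open>B\<close> by a factor \<open>p\<close> shrinks \<open>C B\<close> by at least
  \<open>p\<close>, because \<open>second_center_separates\<close> finds an element that is
  lost.\<close>

lemma card_second_center_ge:
  assumes eq: "center (InnGroup G) = Aut_cZ G"
    and c: "c \<in> center G" "c \<notin> derived G (carrier G)" "ord c = p ^ Suc t"
  shows "card (center G) * p ^ n
    \<le> card (central_mod G (center G)) * card (derived G (carrier G) <#> center G)"
proof -
  let ?D = "derived G (carrier G) <#> center G"
  let ?Z2 = "central_mod G (center G)"
  interpret Z: normal "center G" G by (rule normal_center)
  interpret Z2: normal ?Z2 G by (rule Z.normal_central_mod)
  have sG': "subgroup (derived G (carrier G)) G" by (simp add: derived_is_subgroup)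
  have D: "subgroup ?D G" "derived G (carrier G) \<subseteq> ?D"
    using Z.subgroup_set_mult[OF sG'] Z.subset_set_mult[OF sG'] by blast+
  define C where "C B = {g \<in> ?Z2. \<forall>b\<in>B. g \<otimes> b = b \<otimes> g}" for B
  have sC: "subgroup (C B) G" if B: "subgroup B G" for B
  proof (rule subgroupI)
    interpret B: subgroup B G by fact
    show "C B \<subseteq> carrier G" using Z2.subset by (auto simp: C_def)
    have "\<one> \<in> C B" using subgroup.one_closed[OF Z2.is_subgroup] by (auto simp: C_def)
    then show "C B \<noteq> {}" by blast
    fix a assume a: "a \<in> C B"
    then have ac: "a \<in> carrier G" using \<open>C B \<subseteq> carrier G\<close> by blast
    have "inv a \<otimes> b = b \<otimes> inv a" if "b \<in> B" for b
    proof -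
      have "a \<otimes> inv b = inv b \<otimes> a" using a that by (auto simp: C_def)
      then have "inv (a \<otimes> inv b) = inv (inv b \<otimes> a)" by simp
      then show ?thesis using ac that by (simp add: inv_mult_group)
    qed
    then show "inv a \<in> C B" using a by (auto simp: C_def)
    fix b assume b: "b \<in> C B"
    then have bc: "b \<in> carrier G" using \<open>C B \<subseteq> carrier G\<close> by blast
    have "a \<otimes> b \<otimes> x = x \<otimes> (a \<otimes> b)" if "x \<in> B" for x
    proof -
      have x: "x \<in> carrier G" "a \<otimes> x = x \<otimes> a" "b \<otimes> x = x \<otimes> b" using a b that by (auto simp: C_def)
      have "a \<otimes> b \<otimes> x = a \<otimes> x \<otimes> b" using ac bc x(1,3) by (simp add: m_assoc)
      then show ?thesis using ac bc x(1,2) by (simp add: m_assoc)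
    qed
    then show "a \<otimes> b \<in> C B" using a b by (auto simp: C_def)
  qed
  \<comment> \<open>The induction descends from \<open>B = G\<close>, where \<open>C B\<close> is
    the centre and equality holds.\<close>
  have ind: "card (center G) * p ^ n \<le> card (C B) * card B" if "subgroup B G" "?D \<subseteq> B" for B
    using that
  proof (induction "p ^ n - card B" arbitrary: B rule: less_induct)
    case less
    note B = less.prems
    interpret B: subgroup B G by (rule B(1))
    show ?case
    proof (cases "B = carrier G")
      case True
      have "C (carrier G) = center G"
      proof
        show "C (carrier G) \<subseteq> center G"
          using Z2.subset unfolding C_def center_def by blast
        show "center G \<subseteq> C (carrier G)"
          using Z.subset_central_mod center_commute unfolding C_def by blast
      qed
      then show ?thesis using True card_carrier by simp
    next
      case False
      have "B \<lhd> G" using normal_if_derived_subset B D by blast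
      then obtain B' where B': "subgroup B' G" "B \<subseteq> B'" "card B' = p * card B"
        using supergroup_index_p False by blast
      have cB: "0 < card B"
        using finite_subgroup[OF B(1)] subgroup.one_closed[OF B(1)] by (metis card_gt_0_iff empty_iff)
      then have lt: "card B < card B'" using B' p_gt_1 by simp
      have "card B' \<le> p ^ n"
        using card_mono[OF finite_carrier subgroup.subset[OF B'(1)]] card_carrier by simp
      then have "p ^ n - card B' < p ^ n - card B" using lt by simp
      then have IH: "card (center G) * p ^ n \<le> card (C B') * card B'"
        using less.hyps[OF _ B'(1)] B' B by blast
      obtain y where y: "y \<in> B'" "y \<notin> B" using lt B' by (metis less_irrefl subsetI subset_antisym)
      then have yc: "y \<in> carrier G" using subgroup.mem_carrier[OF B'(1)] by blast
      obtain g where "g \<in> ?Z2" "\<And>b. b \<in> B \<Longrightarrow> g \<otimes> b = b \<otimes> g" "g \<otimes> y \<noteq> y \<otimes> g"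
        using second_center_separates[OF eq c B yc y(2)] by blast
      then have "g \<in> C B" "g \<notin> C B'" using y by (auto simp: C_def)
      moreover have "C B' \<subseteq> C B" using B' by (auto simp: C_def)
      ultimately have "C B' \<subset> C B" by blast
      then have "p * card (C B') \<le> card (C B)"
        using card_subgroup_psubset[OF sC[OF B'(1)] sC[OF B(1)]] by simp
      then have "p * card (C B') * card B \<le> card (C B) * card B" by (rule mult_le_mono1)
      moreover have "card (C B') * card B' = p * card (C B') * card B" using B'(3) by simp
      ultimately show ?thesis using IH by linarith
    qed
  qed
  have "card (C ?D) \<le> card ?Z2"
    using finite_subgroup[OF Z2.is_subgroup] by (auto simp: C_def intro!: card_mono)
  then have "card (C ?D) * card ?D \<le> card ?Z2 * card ?D" by (rule mult_le_mono1)
  with ind[OF D(1) subset_refl] show ?thesis by (rule le_trans)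
qed

section \<open>Nilpotency class and size estimates\<close>

lemma power_mult_power_le_iff: "p ^ i * p ^ j \<le> p ^ k \<longleftrightarrow> i + j \<le> k"
  using p_gt_1 by (simp flip: power_add)

text \<open>Finite p-groups are nilpotent: a proper \<open>N\<close> is strictly smaller than
  \<open>central_mod G N\<close>, and returning from there to \<open>N\<close> costs one more term
  of \<open>lcs\<close>. The case of trivial \<open>N\<close> shows that the \<open>LEAST\<close> in
  \<open>nilpotency_class\<close> is attained.\<close>

lemma ex_lcs_subset: "N \<lhd> G \<Longrightarrow> \<exists>k. lcs G k \<subseteq> N"
proof (induction "p ^ n - card N" arbitrary: N rule: less_induct)
  case less
  interpret N: normal N G by (rule less.prems)
  show ?case
  proof (cases "N = carrier G")
    case True
    then show ?thesis by (intro exI[of _ 0]) simp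
  next
    case False
    interpret C: normal "central_mod G N" G by (rule N.normal_central_mod)
    have "card N < card (central_mod G N)"
      using psubset_card_mono[OF finite_subgroup[OF C.is_subgroup]]
        subset_central_mod_strict[OF less.prems False] by blast
    moreover have "card (central_mod G N) \<le> p ^ n"
      using card_mono[OF finite_carrier C.subset] card_carrier by simp
    ultimately have "p ^ n - card (central_mod G N) < p ^ n - card N" by simp
    then obtain k where "lcs G k \<subseteq> central_mod G N"
      using less.hyps C.normal_axioms by blast
    then have "lcs G (Suc k) \<subseteq> N"
      using lcs_Suc_subset_iff[OF N.is_subgroup subgroup.subset[OF subgroup_lcs]] by blast
    then show ?thesis by blast
  qed
qed

text \<open>Translates the class into the position of \<open>G'\<close> in the upper central
  series.\<close>

lemma nilpotency_class_eq_4_iff: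
  assumes "3 \<le> nilpotency_class G"
  shows "nilpotency_class G = 4 \<longleftrightarrow>
    \<not> derived G (carrier G) \<subseteq> central_mod G (center G) \<and>
    derived G (carrier G) \<subseteq> central_mod G (central_mod G (center G))"
    and "\<not> derived G (carrier G) \<subseteq> center G"
proof -
  interpret Z: normal "center G" G by (rule normal_center)
  interpret Z2: normal "central_mod G (center G)" G by (rule Z.normal_central_mod)
  have one: "lcs G k = {\<one>} \<longleftrightarrow> lcs G k \<subseteq> {\<one>}" for k
    using subgroup.one_closed[OF subgroup_lcs] by blast
  note step = lcs_Suc_subset_iff[OF _ subgroup.subset[OF subgroup_lcs]]
  \<comment> \<open>As \<open>lcs\<close> starts at index 0, its term 1 is \<open>G'\<close>;
    triviality of term \<open>c\<close> therefore places \<open>G'\<close> in term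
    \<open>c - 1\<close> of the upper central series.\<close>
  have l2: "lcs G 2 = {\<one>} \<longleftrightarrow> derived G (carrier G) \<subseteq> center G"
    using one[of 2] lcs_Suc_subset_one_iff[of 1] lcs_1 by (simp add: numeral_2_eq_2 del: lcs.simps)
  have l3: "lcs G 3 = {\<one>} \<longleftrightarrow> derived G (carrier G) \<subseteq> central_mod G (center G)"
    using one[of 3] lcs_Suc_subset_one_iff[of 2] step[OF Z.is_subgroup, of 1] lcs_1
    by (simp add: numeral_2_eq_2 numeral_3_eq_3 del: lcs.simps)
  have l4: "lcs G 4 = {\<one>} \<longleftrightarrow> derived G (carrier G) \<subseteq> central_mod G (central_mod G (center G))"
    using one[of 4] lcs_Suc_subset_one_iff[of 3] step[OF Z.is_subgroup, of 2]
      step[OF Z2.is_subgroup, of 1] lcs_1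
    by (simp add: numeral_2_eq_2 numeral_3_eq_3 eval_nat_numeral del: lcs.simps)
  have lt: "lcs G k \<noteq> {\<one>}" if "k < nilpotency_class G" for k
    using not_less_Least[of k "\<lambda>c. lcs G c = {\<one>}"] that unfolding nilpotency_class_def by blast
  obtain k where "lcs G k = {\<one>}"
    using ex_lcs_subset[OF one_is_normal] one by blast
  then have nil: "lcs G (nilpotency_class G) = {\<one>}"
    unfolding nilpotency_class_def by (rule LeastI)
  have le: "nilpotency_class G \<le> k" if "lcs G k = {\<one>}" for k
    using that unfolding nilpotency_class_def by (rule Least_le)
  show "\<not> derived G (carrier G) \<subseteq> center G" using lt[of 2] assms l2 by simp
  have "nilpotency_class G = 4 \<longleftrightarrow> lcs G 3 \<noteq> {\<one>} \<and> lcs G 4 = {\<one>}"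
  proof
    assume "nilpotency_class G = 4"
    then show "lcs G 3 \<noteq> {\<one>} \<and> lcs G 4 = {\<one>}" using nil lt[of 3] by simp
  next
    assume *: "lcs G 3 \<noteq> {\<one>} \<and> lcs G 4 = {\<one>}"
    then have "nilpotency_class G \<noteq> 3" "nilpotency_class G \<le> 4" using nil le by metis+
    then show "nilpotency_class G = 4" using assms by simp
  qed
  then show "nilpotency_class G = 4 \<longleftrightarrow>
    \<not> derived G (carrier G) \<subseteq> central_mod G (center G) \<and>
    derived G (carrier G) \<subseteq> central_mod G (central_mod G (center G))"
    unfolding l3 l4 .
qed

text \<open>\<open>G/G'Z\<close> is the abelianization of the nonabelian group \<open>G/Z\<close>
  and hence not cyclic, which rules out the indices 1 and \<open>p\<close>.\<close>

lemma card_derived_center_le: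
  assumes "\<not> derived G (carrier G) \<subseteq> center G"
  shows "card (derived G (carrier G) <#> center G) * p\<^sup>2 \<le> p ^ n"
proof (rule ccontr)
  let ?D = "derived G (carrier G) <#> center G"
  assume not: "\<not> card ?D * p\<^sup>2 \<le> p ^ n"
  interpret Z: normal "center G" G by (rule normal_center)
  have sG': "subgroup (derived G (carrier G)) G" by (simp add: derived_is_subgroup)
  have D: "subgroup ?D G" "?D \<lhd> G"
    using Z.subgroup_set_mult[OF sG'] Z.subset_set_mult(1)[OF sG'] normal_if_derived_subset by blast+
  have cyc: False if "a \<in> carrier G" "\<And>x. x \<in> carrier G \<Longrightarrow> \<exists>i::nat. \<exists>c\<in>?D. x = a [^] i \<otimes> c" for a
    using derived_subset_if_cyclic_abelianization[OF normal_center that] assms by blast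
  have "?D \<noteq> carrier G"
  proof
    assume "?D = carrier G"
    then show False
      using cyc[OF one_closed] by (metis l_one nat_pow_0)
  qed
  then have ps: "?D \<subset> carrier G" using subgroup.subset[OF D(1)] by blast
  obtain d where d: "card ?D = p ^ d" using card_subgroup[OF D(1)] by blast
  have "p * card ?D \<le> p ^ n"
    using card_subgroup_psubset[OF D(1) subgroup_self ps] card_carrier by simp
  then have "Suc d \<le> n" using d p_gt_1 by (simp flip: power_Suc)
  moreover have "n < d + 2" using not unfolding d power_mult_power_le_iff by simp
  ultimately have "n = Suc d" by simp
  then have "card ?D * p ^ Suc 0 = p ^ n" using d by simp
  moreover obtain a where a: "a \<in> carrier G" "a \<notin> ?D" using ps by blast
  ultimately have "\<exists>i::nat. \<exists>c\<in>?D. x = a [^] i \<otimes> c" if "x \<in> carrier G" for x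
    using cyclic_FactGroup[OF D(2), of 0 a x] that by simp
  then show False by (rule cyc[OF a(1)])
qed

text \<open>The centre of a nonabelian p-group cannot have index 1 or \<open>p\<close>.\<close>

lemma card_central_mod_le:
  assumes N: "N \<lhd> G" "\<not> derived G (carrier G) \<subseteq> N"
  shows "card (central_mod G N) * p\<^sup>2 \<le> p ^ n"
proof -
  interpret N: normal N G by fact
  obtain k where k: "card (central_mod G N) = p ^ k"
    using card_subgroup[OF normal_imp_subgroup[OF N.normal_central_mod]] by blast
  have "\<not> p ^ n \<le> p ^ k * p"
    using central_mod_eq_carrier_if_index_le[OF N(1)] central_mod_eq_carrier_iff[OF N.is_subgroup] N(2) k
    by auto
  then have "p ^ Suc k < p ^ n" by (simp add: mult.commute)
  then have "Suc k < n" using p_gt_1 power_less_imp_less_exp by blast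
  then show ?thesis unfolding k power_mult_power_le_iff by simp
qed

text \<open>Everything is read off the exponents \<open>a\<close>, \<open>b\<close>,
  \<open>d\<close> of \<open>Z\<close>, \<open>Z2\<close> and \<open>D\<close>. The bounds are
  \<open>t + 2 \<le> a\<close>, \<open>b \<le> 5\<close>, \<open>d \<le> 5\<close> and
  \<open>a + 7 \<le> b + d\<close>. The case \<open>b = 5\<close> would give
  \<open>d \<le> a + 1\<close>, a contradiction; what remains is \<open>a = 2\<close>,
  \<open>b = 4\<close>, \<open>d = 5\<close>.\<close>

lemma invariants_if_center_InnGroup_eq:
  assumes n: "n = 7" and eq: "center (InnGroup G) = Aut_cZ G"
    and nZ: "\<not> center G \<subseteq> derived G (carrier G)" and nG': "\<not> derived G (carrier G) \<subseteq> center G"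
  shows "card (center G) = p\<^sup>2" "\<exists>c\<in>center G. ord c = p\<^sup>2" "card (derived G (carrier G)) = p ^ 4"
    "\<not> derived G (carrier G) \<subseteq> central_mod G (center G)"
    "derived G (carrier G) \<subseteq> central_mod G (central_mod G (center G))"
proof -
  let ?G' = "derived G (carrier G)" and ?Z = "center G" and ?Z2 = "central_mod G (center G)"
  let ?D = "?G' <#> ?Z"
  interpret Z: normal ?Z G by (rule normal_center)
  interpret Z2: normal ?Z2 G by (rule Z.normal_central_mod)
  have sG': "subgroup ?G' G" by (simp add: derived_is_subgroup)
  have D: "subgroup ?D G" "?G' \<subseteq> ?D" "?Z \<subseteq> ?D"
    using Z.subgroup_set_mult[OF sG'] Z.subset_set_mult[OF sG'] by blast+
  obtain a b d where abd: "card ?Z = p ^ a" "card ?Z2 = p ^ b" "card ?D = p ^ d"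
    using card_subgroup[OF Z.is_subgroup] card_subgroup[OF Z2.is_subgroup] card_subgroup[OF D(1)] by blast
  have d5: "d \<le> 5"
    using card_derived_center_le[OF nG'] unfolding abd n power_mult_power_le_iff by simp
  have b5: "b \<le> 5"
    using card_central_mod_le[OF normal_center nG'] unfolding abd n power_mult_power_le_iff by simp
  \<comment> \<open>Order \<open>p\<close> is impossible: \<open>power_mem_derived_center\<close>
    with exponent 0 would put all of \<open>G\<close> into \<open>?D\<close>.\<close>
  have ordc: "\<exists>t. ord c = p ^ Suc (Suc t)" if c: "c \<in> ?Z" "c \<notin> ?G'" for c
  proof -
    have cc: "c \<in> carrier G" by (rule Z.mem_carrier[OF c(1)])
    obtain k where k: "ord c = p ^ k" using ord_eq_power[OF cc] by blast
    have "k \<noteq> 0"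
    proof
      assume "k = 0"
      then have "c = \<one>" using k ord_eq_1[OF cc] by simp
      then show False using c(2) subgroup.one_closed[OF sG'] by simp
    qed
    moreover have "k \<noteq> 1"
    proof
      assume "k = 1"
      then have "x \<in> ?D" if "x \<in> carrier G" for x
        using power_mem_derived_center[OF eq c, of 0 x] k that by simp
      then have "?D = carrier G" using subgroup.subset[OF D(1)] by blast
      then have "p ^ d = p ^ n" using abd card_carrier by simp
      then have "d = n" using p_gt_1 by simp
      then show False using d5 n by simp
    qed
    ultimately show ?thesis using k by (metis One_nat_def not0_implies_Suc)
  qed
  obtain c where c: "c \<in> ?Z" "c \<notin> ?G'" using nZ by blast
  have cc: "c \<in> carrier G" by (rule Z.mem_carrier[OF c(1)])
  obtain t where t: "ord c = p ^ Suc (Suc t)" using ordc[OF c] by blast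
  have "generate G {c} \<subseteq> ?Z" using generate_subgroup_incl[OF _ Z.is_subgroup] c by simp
  then have "ord c \<le> card ?Z"
    using card_mono[OF finite_subgroup[OF Z.is_subgroup]] generate_pow_card[OF cc] by simp
  then have ta: "t + 2 \<le> a" using t abd p_gt_1 by (simp flip: power_Suc)
  have "p ^ a * p ^ n \<le> p ^ b * p ^ d"
    using card_second_center_ge[OF eq c t] abd by simp
  then have abd7: "a + 7 \<le> b + d"
    using n p_gt_1 by (simp flip: power_add)
  \<comment> \<open>Now \<open>Z2\<close> has index \<open>p\<^sup>2\<close>, so \<open>G'\<close>
    and \<open>Z\<close> lie in a common subgroup of order \<open>p ^ Suc a\<close>.\<close>
  have "d \<le> a + 1" if "b = 5"
  proof -
    have "card ?Z2 * p\<^sup>2 = p ^ n" using abd that n by (simp flip: power_add)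
    then obtain H where H: "subgroup H G" "?Z \<subseteq> H" "card H = p * card ?Z" "?G' \<subseteq> H"
      using derived_bound_if_central_mod_index_p_squared[OF normal_center] by blast
    have "?D \<subseteq> H" by (rule Z.set_mult_subset[OF H(1,4,2)])
    from card_mono[OF finite_subgroup[OF H(1)] this]
    have "p ^ d \<le> p ^ Suc a" unfolding H(3) abd by simp
    then show ?thesis using p_gt_1 by (simp del: power_Suc)
  qed
  then have a: "a = 2" and b: "b = 4" and d: "d = 5" and "t = 0"
    using abd7 ta d5 b5 by linarith+
  have oc: "ord c = p\<^sup>2" using t \<open>t = 0\<close> by (simp add: numeral_2_eq_2)
  show cZ: "card ?Z = p\<^sup>2" using abd a by simp
  show "\<exists>c\<in>?Z. ord c = p\<^sup>2" using c oc by blast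
  let ?T = "{x \<in> ?Z. x [^] p = \<one>}"
  \<comment> \<open>By \<open>ordc\<close>, central elements killed by \<open>p\<close> lie in
    \<open>G'\<close>. Thus \<open>G' \<inter> Z\<close> has order \<open>p\<close>, and the product
    formula yields the order of \<open>G'\<close>.\<close>
  have "?T \<subseteq> ?G' \<inter> ?Z"
  proof
    fix x assume x: "x \<in> ?T"
    have "x \<in> ?G'"
    proof (rule ccontr)
      assume "x \<notin> ?G'"
      then obtain s where "ord x = p ^ Suc (Suc s)" using ordc x by blast
      moreover have "ord x dvd p ^ 1" using x pow_eq_id[of x p] Z.mem_carrier by auto
      ultimately have "Suc (Suc s) \<le> 1" using p_gt_1 power_dvd_imp_le by metis
      then show False by simp
    qed
    then show "x \<in> ?G' \<inter> ?Z" using x by blast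
  qed
  have sI: "subgroup (?G' \<inter> ?Z) G" by (rule subgroups_Inter_pair[OF sG' Z.is_subgroup])
  have "p \<le> card (?G' \<inter> ?Z)"
    using card_mono[OF finite_subgroup[OF sI] \<open>?T \<subseteq> ?G' \<inter> ?Z\<close>]
      card_p_torsion[OF Z.is_subgroup cZ c(1) oc] by simp
  moreover have "?G' \<inter> ?Z \<subset> ?Z" using c by blast
  then have "p * card (?G' \<inter> ?Z) \<le> p * p"
    using card_subgroup_psubset[OF sI Z.is_subgroup] cZ by (simp add: power2_eq_square)
  then have "card (?G' \<inter> ?Z) \<le> p" using p_gt_1 by simp
  ultimately have "card (?G' \<inter> ?Z) = p" by simp
  then have "p ^ 5 * p = card ?G' * p\<^sup>2"
    using Z.card_set_mult[OF sG'] abd d cZ by simp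
  moreover have "p ^ 5 * p = p ^ 4 * p\<^sup>2" by (simp flip: power_add power_Suc2)
  ultimately have "card ?G' * p\<^sup>2 = p ^ 4 * p\<^sup>2" by metis
  then show "card ?G' = p ^ 4" using p_gt_1 by (metis mult_right_cancel not_one_less_zero power_not_zero)
  show "\<not> ?G' \<subseteq> ?Z2"
  proof
    assume "?G' \<subseteq> ?Z2"
    then have "?D \<subseteq> ?Z2" using Z.set_mult_subset[OF Z2.is_subgroup] Z.subset_central_mod by blast
    from card_mono[OF finite_subgroup[OF Z2.is_subgroup] this]
    have "p ^ d \<le> p ^ b" unfolding abd .
    then show False using b d p_gt_1 by simp
  qed
  have "?Z2 \<noteq> carrier G"
  proof
    assume "?Z2 = carrier G"
    then have "p ^ b = p ^ n" using abd card_carrier by simp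
    then show False using b n p_gt_1 by simp
  qed
  \<comment> \<open>The next term of the upper central series has order at least
    \<open>p ^ 5\<close>, so its quotient has order at most \<open>p\<^sup>2\<close> and is
    abelian.\<close>
  then have "?Z2 \<subset> central_mod G ?Z2"
    using subset_central_mod_strict[OF Z2.normal_axioms] by simp
  then have "p * p ^ b \<le> card (central_mod G ?Z2)"
    using card_subgroup_psubset[OF Z2.is_subgroup normal_imp_subgroup[OF Z2.normal_central_mod]] abd by simp
  then have "p * p ^ b * p\<^sup>2 \<le> card (central_mod G ?Z2) * p\<^sup>2" by (rule mult_le_mono1)
  moreover have "p * p ^ b * p\<^sup>2 = p ^ n" using b n by (simp flip: power_add power_Suc)
  ultimately show "?G' \<subseteq> central_mod G ?Z2"
    using derived_subset_if_index_le_p_squared[OF Z2.normal_central_mod] by simp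
qed

end

section \<open>Counting central automorphisms\<close>

context group
begin

lemma pow_card_subgroup:
  assumes "subgroup H G" "x \<in> H" shows "x [^] card H = \<one>"
proof -
  interpret H: group "G\<lparr>carrier := H\<rparr>" using assms subgroup_imp_group by blast
  show ?thesis
    using H.pow_order_eq_1[of x] assms by (simp add: order_def flip: nat_pow_consistent)
qed

text \<open>The values of \<open>h\<close> commute with each other, so commutators lie in the
  kernel.\<close>

lemma hom_derived_eq_one:
  assumes h: "h \<in> hom G G" "h ` carrier G \<subseteq> center G" and u: "u \<in> derived G (carrier G)"
  shows "h u = \<one>"
proof -
  interpret h: group_hom G G h using h by (simp add: group_hom_def group_hom_axioms_def is_group)
  have "h (x \<otimes> y \<otimes> inv x \<otimes> inv y) = \<one>" if "x \<in> carrier G" "y \<in> carrier G" for x y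
  proof -
    have "h x \<otimes> h y = h y \<otimes> h x" using center_commute[of "h x" "h y"] subsetD[OF h(2) imageI[OF that(1)]] that by simp
    then show ?thesis using that commutator_eq_one_iff[of "h x" "h y"] by simp
  qed
  then have "central_mod G (kernel G G h) = carrier G" by (auto simp: central_mod_def kernel_def)
  then have "derived G (carrier G) \<subseteq> kernel G G h"
    using central_mod_eq_carrier_iff[OF h.subgroup_kernel] by simp
  then show ?thesis using u by (auto simp: kernel_def)
qed

lemma subgroup_equalizer:
  assumes "h \<in> hom G H" "k \<in> hom G H" "group H"
  shows "subgroup {x \<in> carrier G. h x = k x} G"
proof -
  interpret h: group_hom G H h using assms by (simp add: group_hom_def group_hom_axioms_def is_group)
  interpret k: group_hom G H k using assms by (simp add: group_hom_def group_hom_axioms_def is_group)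
  show ?thesis by (rule subgroupI) auto
qed

end

context p_group
begin

text \<open>Take \<open>B\<close> of index \<open>p\<close> between \<open>D\<close> and
  \<open>G\<close>, then \<open>x\<close> in \<open>B\<close> but not in \<open>D\<close>, and
  \<open>y\<close> outside \<open>B\<close>. A subgroup containing \<open>D\<close>,
  \<open>x\<close> and \<open>y\<close> must first swallow \<open>B\<close> and then all of
  \<open>G\<close>.\<close>

lemma generators_if_index_p_squared:
  assumes D: "D \<lhd> G" "card D * p\<^sup>2 = p ^ n"
  obtains x y where "x \<in> carrier G" "y \<in> carrier G"
    "\<And>E. subgroup E G \<Longrightarrow> D \<subseteq> E \<Longrightarrow> x \<in> E \<Longrightarrow> y \<in> E \<Longrightarrow> E = carrier G"
proof -
  interpret D: normal D G by fact
  have pos: "0 < card D"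
    using finite_subgroup[OF D.is_subgroup] subgroup.one_closed[OF D.is_subgroup] by (metis card_gt_0_iff empty_iff)
  have pn: "p * (p * card D) = p ^ n" using D(2) by (simp add: power2_eq_square ac_simps)
  have lt: "card D < p * card D" "p * card D < p ^ n" using pos p_gt_1 unfolding pn[symmetric] by simp_all
  then have "D \<noteq> carrier G" using card_carrier by auto
  then obtain B where B: "subgroup B G" "D \<subseteq> B" "card B = p * card D"
    using supergroup_index_p[OF D(1)] by blast
  have "D \<noteq> B" "B \<noteq> carrier G" using B(3) lt card_carrier by auto
  then obtain x y where x: "x \<in> B" "x \<notin> D" and y: "y \<in> carrier G" "y \<notin> B"
    using B(2) subgroup.subset[OF B(1)] by blast
  have "E = carrier G" if E: "subgroup E G" "D \<subseteq> E" "x \<in> E" "y \<in> E" for E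
  proof -
    have sI: "subgroup (E \<inter> B) G" by (rule subgroups_Inter_pair[OF E(1) B(1)])
    have "D \<subset> E \<inter> B" using E B x by blast
    then have "card B \<le> card (E \<inter> B)" using card_subgroup_psubset[OF D.is_subgroup sI] B(3) by simp
    then have "E \<inter> B = B" using card_seteq[OF finite_subgroup[OF B(1)]] by simp
    then have "B \<subset> E" using E y by blast
    then have "card (carrier G) \<le> card E"
      using card_subgroup_psubset[OF B(1) E(1)] B(3) pn card_carrier by simp
    then show ?thesis using card_seteq[OF finite_carrier subgroup.subset[OF E(1)]] by simp
  qed
  then show ?thesis using that x y subgroup.mem_carrier[OF B(1)] by blast
qed

text \<open>Otherwise \<open>x\<close> would generate the quotient of order
  \<open>p\<^sup>2\<close>, and a cyclic abelianization of \<open>G/Z\<close> makes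
  \<open>G/Z\<close> abelian.\<close>

lemma power_p_mem_derived_center:
  assumes nG': "\<not> derived G (carrier G) \<subseteq> center G"
    and card: "card (derived G (carrier G) <#> center G) * p\<^sup>2 = p ^ n"
    and x: "x \<in> carrier G"
  shows "x [^] p \<in> derived G (carrier G) <#> center G"
proof (rule ccontr)
  let ?D = "derived G (carrier G) <#> center G"
  assume not: "x [^] p \<notin> ?D"
  interpret Z: normal "center G" G by (rule normal_center)
  have sG': "subgroup (derived G (carrier G)) G" by (simp add: derived_is_subgroup)
  have D: "?D \<lhd> G"
    using Z.subgroup_set_mult[OF sG'] Z.subset_set_mult(1)[OF sG'] normal_if_derived_subset by blast
  have "card ?D * p ^ Suc 1 = p ^ n" using card by (simp add: power2_eq_square)
  then have "\<exists>i::nat. \<exists>c\<in>?D. u = x [^] i \<otimes> c" if "u \<in> carrier G" for u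
    using cyclic_FactGroup[OF D, of 1 x u] x not that by simp
  then show False
    using derived_subset_if_cyclic_abelianization[OF normal_center x] nG' by blast
qed

text \<open>The map \<open>h \<alpha>\<close> is trivial on \<open>?D\<close> and is thus determined
  by its values at two elements generating \<open>G\<close> modulo \<open>?D\<close>. Since
  \<open>G/?D\<close> is killed by \<open>p\<close>, these values are central elements killed by
  \<open>p\<close>.\<close>

lemma card_Aut_cZ_le:
  assumes nG': "\<not> derived G (carrier G) \<subseteq> center G"
    and card: "card (derived G (carrier G) <#> center G) * p\<^sup>2 = p ^ n"
  shows "finite (Aut_cZ G)" "card (Aut_cZ G) \<le> (card {x \<in> center G. x [^] p = \<one>})\<^sup>2"
proof -
  let ?D = "derived G (carrier G) <#> center G"
  let ?T = "{x \<in> center G. x [^] p = \<one>}"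
  interpret Z: normal "center G" G by (rule normal_center)
  have sG': "subgroup (derived G (carrier G)) G" by (simp add: derived_is_subgroup)
  have nD: "?D \<lhd> G"
    using Z.subgroup_set_mult[OF sG'] Z.subset_set_mult(1)[OF sG'] normal_if_derived_subset by blast
  obtain x y where xy: "x \<in> carrier G" "y \<in> carrier G"
    "\<And>E. subgroup E G \<Longrightarrow> ?D \<subseteq> E \<Longrightarrow> x \<in> E \<Longrightarrow> y \<in> E \<Longrightarrow> E = carrier G"
    using generators_if_index_p_squared[OF nD card] by blast
  define h where "h \<alpha> u = inv u \<otimes> \<alpha> u" for \<alpha> u
  have hom: "h \<alpha> \<in> hom G G" and hZ: "h \<alpha> ` carrier G \<subseteq> center G"
    and fixZ: "\<And>z. z \<in> center G \<Longrightarrow> \<alpha> z = z" and ext: "\<alpha> \<in> extensional (carrier G)"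
    and c: "\<And>u. u \<in> carrier G \<Longrightarrow> \<alpha> u \<in> carrier G" if "\<alpha> \<in> Aut_cZ G" for \<alpha>
    using that Aut_c_hom[of \<alpha>] unfolding h_def
    by (auto simp: Aut_cZ_def Aut_c_def auto_def Bij_def hom_def)
  have hD: "h \<alpha> u = \<one>" if \<alpha>: "\<alpha> \<in> Aut_cZ G" and u: "u \<in> ?D" for \<alpha> u
  proof -
    interpret h: group_hom G G "h \<alpha>"
      using hom[OF \<alpha>] by (simp add: group_hom_def group_hom_axioms_def is_group)
    have "derived G (carrier G) \<subseteq> kernel G G (h \<alpha>)"
      using hom_derived_eq_one[OF hom[OF \<alpha>] hZ[OF \<alpha>]] subgroup.subset[OF sG'] by (auto simp: kernel_def)
    moreover have "center G \<subseteq> kernel G G (h \<alpha>)"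
      using fixZ[OF \<alpha>] Z.mem_carrier by (auto simp: kernel_def h_def)
    ultimately have "?D \<subseteq> kernel G G (h \<alpha>)" by (rule Z.set_mult_subset[OF h.subgroup_kernel])
    then show ?thesis using u by (auto simp: kernel_def)
  qed
  have hT: "h \<alpha> u \<in> ?T" if \<alpha>: "\<alpha> \<in> Aut_cZ G" and u: "u \<in> carrier G" for \<alpha> u
  proof -
    interpret h: group_hom G G "h \<alpha>"
      using hom[OF \<alpha>] by (simp add: group_hom_def group_hom_axioms_def is_group)
    have "h \<alpha> u [^] p = \<one>"
      using h.hom_nat_pow[OF u, of p] hD[OF \<alpha> power_p_mem_derived_center[OF nG' card u]] by simp
    then show ?thesis using hZ[OF \<alpha>] u by blast
  qed
  let ?f = "\<lambda>\<alpha>. (h \<alpha> x, h \<alpha> y)"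
  have inj: "inj_on ?f (Aut_cZ G)"
  proof (rule inj_onI)
    fix \<alpha> \<beta> assume ab: "\<alpha> \<in> Aut_cZ G" "\<beta> \<in> Aut_cZ G" "?f \<alpha> = ?f \<beta>"
    \<comment> \<open>The equalizer is a subgroup containing \<open>?D\<close> and both
      generators.\<close>
    let ?E = "{u \<in> carrier G. h \<alpha> u = h \<beta> u}"
    have "?E = carrier G"
    proof (rule xy(3))
      show "subgroup ?E G" using subgroup_equalizer hom ab is_group by blast
      show "?D \<subseteq> ?E" using hD ab subgroup.subset[OF normal_imp_subgroup[OF nD]] by auto
    qed (use ab xy in auto)
    then have eq: "inv u \<otimes> \<alpha> u = inv u \<otimes> \<beta> u" if "u \<in> carrier G" for u
      using that unfolding h_def by blast
    have "\<alpha> u = \<beta> u" if u: "u \<in> carrier G" for u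
      using eq[OF u] c[OF ab(1) u] c[OF ab(2) u] u by simp
    then show "\<alpha> = \<beta>" using ext ab extensionalityI by blast
  qed
  have img: "?f ` Aut_cZ G \<subseteq> ?T \<times> ?T" using hT xy by blast
  have "finite ?T" using finite_subgroup[OF Z.is_subgroup] by simp
  then have fin: "finite (?T \<times> ?T)" by simp
  show "finite (Aut_cZ G)" using inj_on_finite[OF inj img fin] .
  show "card (Aut_cZ G) \<le> (card ?T)\<^sup>2"
    using card_inj_on_le[OF inj img fin] by (simp add: card_cartesian_product power2_eq_square)
qed

text \<open>The orders of \<open>G'\<close> and \<open>Z\<close> give \<open>d + k = 6\<close>,
  where \<open>p ^ k\<close> is the order of \<open>G' \<inter> Z\<close>; with
  \<open>k \<le> 1\<close> and \<open>d \<le> 5\<close> this fixes both. Class 4 then gives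
  \<open>b = 4\<close>, so \<open>Z(Inn G)\<close> has order \<open>p\<^sup>2\<close>, the upper
  bound for \<open>Aut_cZ G\<close>.\<close>

lemma center_InnGroup_eq_if_invariants:
  assumes n: "n = 7" and cZ: "card (center G) = p\<^sup>2" and c0: "c0 \<in> center G" "ord c0 = p\<^sup>2"
    and cG': "card (derived G (carrier G)) = p ^ 4"
    and nZ: "\<not> center G \<subseteq> derived G (carrier G)" and nG': "\<not> derived G (carrier G) \<subseteq> center G"
    and nZ2: "\<not> derived G (carrier G) \<subseteq> central_mod G (center G)"
    and Z3: "derived G (carrier G) \<subseteq> central_mod G (central_mod G (center G))"
  shows "center (InnGroup G) = Aut_cZ G" "Aut_cZ G \<subset> Aut_c G"
proof -
  let ?G' = "derived G (carrier G)" and ?Z = "center G" and ?Z2 = "central_mod G (center G)"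
  let ?D = "?G' <#> ?Z" and ?T = "{x \<in> center G. x [^] p = \<one>}"
  interpret Z: normal ?Z G by (rule normal_center)
  interpret Z2: normal ?Z2 G by (rule Z.normal_central_mod)
  interpret Z3: normal "central_mod G ?Z2" G by (rule Z2.normal_central_mod)
  have sG': "subgroup ?G' G" by (simp add: derived_is_subgroup)
  have D: "subgroup ?D G" "?G' \<subseteq> ?D" "?Z \<subseteq> ?D"
    using Z.subgroup_set_mult[OF sG'] Z.subset_set_mult[OF sG'] by blast+
  obtain b d e where bde: "card ?Z2 = p ^ b" "card ?D = p ^ d" "card (central_mod G ?Z2) = p ^ e"
    using card_subgroup[OF Z2.is_subgroup] card_subgroup[OF D(1)] card_subgroup[OF Z3.is_subgroup] by blast
  have d5: "d \<le> 5"
    using card_derived_center_le[OF nG'] unfolding bde n power_mult_power_le_iff by simp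
  have sI: "subgroup (?G' \<inter> ?Z) G" by (rule subgroups_Inter_pair[OF sG' Z.is_subgroup])
  obtain k where k: "card (?G' \<inter> ?Z) = p ^ k" using card_subgroup[OF sI] by blast
  have "?G' \<inter> ?Z \<subset> ?Z" using nZ by blast
  then have "p * p ^ k \<le> p\<^sup>2"
    using card_subgroup_psubset[OF sI Z.is_subgroup] cZ k by simp
  then have "p ^ Suc k \<le> p\<^sup>2" by simp
  then have "k \<le> 1" using p_gt_1 power_le_imp_le_exp[of p "Suc k" 2] by simp
  moreover have "p ^ d * p ^ k = p ^ 4 * p\<^sup>2"
    using Z.card_set_mult[OF sG'] bde k cG' cZ by simp
  then have "p ^ (d + k) = p ^ 6" by (simp add: power_add)
  then have "d + k = 6" using p_gt_1 power_inject_exp by blast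
  ultimately have d: "d = 5" and "k = 1" using d5 by linarith+
  then have kI: "card (?G' \<inter> ?Z) = p" using k by simp
  have "?G' \<inter> ?Z \<subseteq> ?T" using pow_card_subgroup[OF sI] kI by auto
  moreover have cT: "card ?T = p" by (rule card_p_torsion[OF Z.is_subgroup cZ c0])
  moreover have "finite ?T" using finite_subgroup[OF Z.is_subgroup] by simp
  ultimately have T: "?G' \<inter> ?Z = ?T" using kI card_subset_eq by metis
  have cD: "card ?D * p\<^sup>2 = p ^ n" unfolding bde d n by (simp flip: power_add)
  \<comment> \<open>Class 4 puts \<open>?D\<close> into the third centre, whose order is then
    exactly \<open>p ^ 5\<close>. A bound for \<open>G'\<close> modulo \<open>Z2\<close> follows,
    and with it \<open>4 \<le> b\<close>.\<close>
  have "?D \<subseteq> central_mod G ?Z2"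
    using Z.set_mult_subset[OF Z3.is_subgroup Z3] Z.subset_central_mod Z2.subset_central_mod by blast
  from card_mono[OF finite_subgroup[OF Z3.is_subgroup] this]
  have "p ^ d \<le> p ^ e" unfolding bde .
  then have "5 \<le> e" using d p_gt_1 power_le_imp_le_exp by blast
  moreover have "e \<le> 5"
    using card_central_mod_le[OF Z2.normal_axioms nZ2] unfolding bde n power_mult_power_le_iff by simp
  ultimately have "card (central_mod G ?Z2) * p\<^sup>2 = p ^ n" unfolding bde n by (simp flip: power_add)
  then obtain H where H: "subgroup H G" "?Z2 \<subseteq> H" "card H = p * card ?Z2" "?G' \<subseteq> H"
    using derived_bound_if_central_mod_index_p_squared[OF Z2.normal_axioms] by blast
  have "?D \<subseteq> H" using Z.set_mult_subset[OF H(1,4)] H(2) Z.subset_central_mod by blast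
  from card_mono[OF finite_subgroup[OF H(1)] this]
  have "p ^ d \<le> p ^ Suc b" unfolding H(3) bde by simp
  then have b4: "4 \<le> b" using d p_gt_1 power_le_imp_le_exp[of p d "Suc b"] by simp
  have b5: "b \<le> 5"
    using card_central_mod_le[OF normal_center nG'] unfolding bde n power_mult_power_le_iff by simp
  \<comment> \<open>With \<open>Z2\<close> of index \<open>p\<^sup>2\<close>, the group
    \<open>?D\<close> of order \<open>p ^ 5\<close> would fit into a subgroup of order
    \<open>p ^ 3\<close>.\<close>
  have "b \<noteq> 5"
  proof
    assume "b = 5"
    then have "card ?Z2 * p\<^sup>2 = p ^ n" unfolding bde n by (simp flip: power_add)
    then obtain H where H: "subgroup H G" "?Z \<subseteq> H" "card H = p * card ?Z" "?G' \<subseteq> H"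
      using derived_bound_if_central_mod_index_p_squared[OF normal_center] by blast
    have "?D \<subseteq> H" by (rule Z.set_mult_subset[OF H(1,4,2)])
    from card_mono[OF finite_subgroup[OF H(1)] this]
    have "p ^ d \<le> p ^ Suc 2" unfolding H(3) bde cZ by (simp only: power_Suc)
    then show False using d p_gt_1 power_le_imp_le_exp[of p d "Suc 2"] by simp
  qed
  then have "b = 4" using b4 b5 by simp
  then have "card (center (InnGroup G)) * p\<^sup>2 = p\<^sup>2 * p\<^sup>2"
    using card_center_InnGroup bde cZ by (simp flip: power_add)
  then have "card (center (InnGroup G)) = p\<^sup>2"
    using p_gt_1 by (metis mult_right_cancel not_one_less_zero power_not_zero)
  then show "center (InnGroup G) = Aut_cZ G"
    using card_Aut_cZ_le[OF nG' cD] cT card_seteq[OF _ center_InnGroup_subset_Aut_cZ] by simp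
  obtain c where c: "c \<in> ?Z" "c \<notin> ?G'" using nZ by blast
  have cc: "c \<in> carrier G" by (rule Z.mem_carrier[OF c(1)])
  have pZ: "z [^] p \<in> ?G'" if z: "z \<in> ?Z" for z
  proof -
    have "(z [^] p) [^] p = \<one>"
      using pow_card_subgroup[OF Z.is_subgroup z] Z.mem_carrier[OF z] cZ
      by (simp add: nat_pow_pow power2_eq_square)
    then have "z [^] p \<in> ?T" using pow_mem_center[OF z] by simp
    then show ?thesis using T by blast
  qed
  \<comment> \<open>The order divides that of \<open>Z\<close>, and it does not divide
    \<open>p\<close> because \<open>?T\<close> lies in \<open>G'\<close>.\<close>
  have oc: "ord c = p\<^sup>2"
  proof -
    obtain k where k: "ord c = p ^ k" using ord_eq_power[OF cc] by blast
    have "p ^ k dvd p\<^sup>2" using pow_card_subgroup[OF Z.is_subgroup c(1)] pow_eq_id[OF cc] cZ k by simp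
    then have "k \<le> 2" using p_gt_1 power_dvd_imp_le by blast
    moreover have "c \<notin> ?T" using T c by blast
    then have "\<not> p ^ k dvd p ^ 1" using pow_eq_id[OF cc, of p] k c(1) by simp
    then have "\<not> k \<le> 1" using le_imp_power_dvd by blast
    ultimately have "k = 2" by simp
    then show ?thesis using k by simp
  qed
  \<comment> \<open>This bounds the exponent of \<open>G/G'\<close>, hence \<open>j\<close> below,
    so that the powers of \<open>c\<close> include an element of order exactly
    \<open>p ^ j\<close>.\<close>
  have exp: "x [^] (p\<^sup>2) \<in> ?G'" if x: "x \<in> carrier G" for x
  proof -
    obtain a z where az: "a \<in> ?G'" "z \<in> ?Z" "x [^] p = a \<otimes> z"
      using power_p_mem_derived_center[OF nG' cD x] by (auto simp: set_mult_def)
    have ac: "a \<in> carrier G" and zc: "z \<in> carrier G"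
      using subgroup.mem_carrier[OF sG' az(1)] Z.mem_carrier[OF az(2)] .
    have "a [^] p \<in> ?G'" using subgroup_int_pow_closed[OF sG' az(1), of "int p"] by (simp add: int_pow_int)
    have "x [^] (p\<^sup>2) = (a \<otimes> z) [^] p"
      using x az(3) by (simp add: power2_eq_square flip: nat_pow_pow)
    also have "\<dots> = a [^] p \<otimes> z [^] p"
      using pow_mult_distrib[of a z p] center_commute[OF az(2) ac] ac zc by simp
    also have "\<dots> \<in> ?G'" using \<open>a [^] p \<in> ?G'\<close> pZ[OF az(2)] subgroup.m_closed[OF sG'] by blast
    finally show ?thesis .
  qed
  show "Aut_cZ G \<subset> Aut_c G"
  proof (rule separating_hom[OF sG' subset_refl cc c(2)])
    fix j
    assume j: "\<And>t. (\<And>x. x \<in> carrier G \<Longrightarrow> x [^] (p ^ t) \<in> ?G') \<Longrightarrow> j \<le> t"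
      and sep: "\<And>z. z \<in> carrier G \<Longrightarrow> z [^] (p ^ j) = \<one> \<Longrightarrow>
        \<exists>h \<in> hom G G. (\<forall>b\<in>?G'. h b = \<one>) \<and> z \<in> h ` carrier G \<and>
          (\<forall>x\<in>carrier G. \<exists>i::nat. h x = z [^] i) \<and> (ord z = p ^ j \<longrightarrow> h c \<noteq> \<one>)"
    have j2: "j \<le> 2" using exp by (rule j)
    define z where "z = c [^] (p ^ (2 - j))"
    have z: "z \<in> ?Z" "z \<in> carrier G"
      using pow_mem_center[OF c(1)] Z.subset unfolding z_def by blast+
    have "p\<^sup>2 = p ^ (2 - j) * p ^ j" using j2 by (simp flip: power_add)
    then have oz: "ord z = p ^ j"
      using ord_pow[OF cc, of "p ^ (2 - j)"] oc p_gt_1 unfolding z_def by simp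
    then have "z [^] (p ^ j) = \<one>" using pow_eq_id[OF z(2)] by simp
    then obtain h where h: "h \<in> hom G G" "\<forall>b\<in>?G'. h b = \<one>"
      "\<forall>x\<in>carrier G. \<exists>i::nat. h x = z [^] i" "h c \<noteq> \<one>"
      using sep[OF z(2)] oz by blast
    interpret h: group_hom G G h
      using h(1) by (simp add: group_hom_def group_hom_axioms_def is_group)
    have hZ: "h ` carrier G \<subseteq> center G" using h(3) pow_mem_center[OF z(1)] by fastforce
    have "(\<lambda>x\<in>carrier G. x \<otimes> h x) \<in> Aut_c G"
    proof (rule mem_Aut_cI[OF finite_carrier h(1) hZ])
      fix x assume x: "x \<in> ?Z" "x \<otimes> h x = \<one>"
      have xc: "x \<in> carrier G" by (rule Z.mem_carrier[OF x(1)])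
      \<comment> \<open>Injectivity on the centre: \<open>x [^] p\<close> lies in \<open>G'\<close>,
        so \<open>h x\<close> is killed by \<open>p\<close> and then so is \<open>x\<close>. This
        puts \<open>x\<close> into \<open>?T\<close> and hence into \<open>G'\<close>, where
        \<open>h\<close> is trivial.\<close>
      have "h x [^] p = \<one>" using h.hom_nat_pow[OF xc, of p] h(2) pZ[OF x(1)] by simp
      moreover have "(x \<otimes> h x) [^] p = x [^] p \<otimes> h x [^] p"
        using pow_mult_distrib[of x "h x" p] center_commute[OF x(1)] xc by simp
      ultimately have "x [^] p = \<one>" using x(2) xc by simp
      then have "x \<in> ?G'" using T x(1) by blast
      then show "x = \<one>" using h(2) x(2) xc by simp
    qed
    moreover have "(\<lambda>x\<in>carrier G. x \<otimes> h x) c \<noteq> c" using h(4) cc by simp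
    then have "(\<lambda>x\<in>carrier G. x \<otimes> h x) \<notin> Aut_cZ G" using c(1) by (auto simp only: Aut_cZ_def)
    moreover have "Aut_cZ G \<subseteq> Aut_c G" by (auto simp: Aut_cZ_def)
    ultimately show ?thesis by blast
  qed
qed

end

section \<open>The equivalence for groups of order p^7\<close>

theorem theorem2p4:
  fixes G :: "('a, 'b) monoid_scheme" and p :: nat
  assumes "group G" and "Factorial_Ring.prime p"
    and "order G = p ^ 7"
    and "\<not> center G \<subseteq> commutator_subgroup G"
    and "nilpotency_class G \<ge> 3"
  shows "(center (InnGroup G) = Aut_cZ G \<and> Aut_cZ G \<subset> Aut_c G) \<longleftrightarrow>
         (G\<lparr>carrier := center G\<rparr> \<cong> integer_mod_group (p ^ 2)
          \<and> card (commutator_subgroup G) = p ^ 4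
          \<and> nilpotency_class G = 4)"
proof -
  interpret p_group G p 7
    using assms(1-3) by (simp add: p_group_def p_group_axioms_def)
  note nil = nilpotency_class_eq_4_iff[OF assms(5)]
  show ?thesis
  proof (intro iffI conjI)
    assume L: "center (InnGroup G) = Aut_cZ G \<and> Aut_cZ G \<subset> Aut_c G"
    note inv = invariants_if_center_InnGroup_eq[OF refl conjunct1[OF L] assms(4) nil(2)]
    obtain c where "c \<in> center G" "ord c = p\<^sup>2" using inv(2) by blast
    then show "G\<lparr>carrier := center G\<rparr> \<cong> integer_mod_group (p ^ 2)"
      using subgroup_iso_integer_mod_group[OF subgroup_center finite_subgroup[OF subgroup_center]] inv(1)
      by metis
    show "card (commutator_subgroup G) = p ^ 4" by (rule inv(3))
    show "nilpotency_class G = 4" using nil(1) inv(4,5) by blast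
  next
    assume R: "G\<lparr>carrier := center G\<rparr> \<cong> integer_mod_group (p ^ 2)
      \<and> card (commutator_subgroup G) = p ^ 4 \<and> nilpotency_class G = 4"
    have p2: "1 < p\<^sup>2" using p_gt_1 by (intro one_less_power) simp_all
    obtain c where c: "c \<in> center G" "ord c = p\<^sup>2"
      using generator_if_iso_integer_mod_group[OF subgroup_center conjunct1[OF R] p2] .
    have "card (center G) = p\<^sup>2"
      using iso_same_card[OF conjunct1[OF R]] p2 by (simp add: carrier_integer_mod_group nat_power_eq)
    note bwd = center_InnGroup_eq_if_invariants[OF refl this c _ assms(4) nil(2)]
    show "center (InnGroup G) = Aut_cZ G" "Aut_cZ G \<subset> Aut_c G"
      using bwd nil(1) R by blast+
  qed
qed

end
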